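(* Let $(\Omega,d,\mu)$ be an $RD$-space, $X$ an r.i. space on $\Omega$, $E$ a parameter, $b\in SV$ and $0<\theta<\infty$. Suppose that $1\le p<q<\infty$. Then there is a constant $C>0$ such that for all $f$, $$\|f\|_{\mathring{B}_{X,E^{(q)}}^{\theta,b}}\le C\,\|f\|_{\mathring{B}_{X,E^{(p)}}^{\theta,b}}.$$ The same embedding holds for the inhomogeneous spaces, i.e. there is $C>0$ such that $\|f\|_{B_{X,E^{(q)}}^{\theta,b}}\le C\|f\|_{B_{X,E^{(p)}}^{\theta,b}}$ for all $f$.
   Context: Metric measure space: $(\Omega,d)$ is a metric space with a Borel measure $\mu$ (induced by a Borel regular outer measure) such that $0<\mu(B)<\infty$ for every ball $B$ and $\mu(\{x\})=0$ for all $x\in\Omega$; $B(x,r)=\{y:d(x,y)<r\}$. It is an $RD$-space with indices $(k,n)$, $0<k\le n$, if there are constants $0<C_1\le 1\le C_2$ with $C_1\lambda^k\mu(B(x,r))\le\mu(B(x,\lambda r))\le C_2\lambda^n\mu(B(x,r))$ for all $x\in\Omega$, $r>0$, $\lambda\ge1$. R.i. space: a Banach function space $X$ on $(\Omega,\mu)$ with the Fatou property such that, if $g\in X$ and $f^*\le g^*$ a.e., then $f\in X$ and $\|f\|_X\le\|g\|_X$; here $f^*(s)=\inf\{t\ge0:\mu\{|f|>t\}\le s\}$ is the decreasing rearrangement. For $1\le p<\infty$, the $p$-convexification of an r.i. space $Y$ is $Y^{(p)}=\{f:|f|^p\in Y\}$ with $\|f\|_{Y^{(p)}}=\||f|^p\|_Y^{1/p}$.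 Parameter: an r.i. space $E$ on $(0,\infty)$ with Lebesgue measure. One assumes $E=\mathcal F(L^1,L^\infty)$ for an exact interpolation functor $\mathcal F$, and puts $\tilde E:=\mathcal F(\tilde L^1,L^\infty)$ where $\|g\|_{\tilde L^1}=\int_0^\infty|g(t)|\frac{dt}{t}$; $\tilde E$ is an r.i. space with respect to $dt/t$, and concretely $\|g\|_{\tilde E(0,1)}=\|g(e^{-u})\|_{E(0,\infty)}$, $\|g\|_{\tilde E(1,\infty)}=\|g(e^{u})\|_{E(0,\infty)}$, $\|g\|_{\tilde E}\simeq\|g\|_{\tilde E(0,1)}+\|g\|_{\tilde E(1,\infty)}$, where $\|g\|_{\tilde E(I)}=\|g\chi_I\|_{\tilde E}$. For the parameter $E^{(p)}$ the corresponding space with respect to $dt/t$ is $\tilde E^{(p)}$. $b\in SV$ (slowly varying): $b$ is a positive Lebesgue measurable function on $(0,\infty)$ such that for every $\varepsilon>0$, $t^\varepsilon b(t)$ is equivalent (up to multiplicative constants) to an increasing function and $t^{-\varepsilon}b(t)$ to a decreasing function on $(0,\infty)$. Besov spaces: $E_X(f,t)=\left\|x\mapsto\frac1{\mu(B(x,t))}\int_{B(x,t)}|f(x)-f(y)|\,d\mu(y)\right\|_X$. $\mathring B^{\theta,b}_{X,E}$ is the set of $f\in L^1+L^\infty$ with $\|f\|_{\mathring B^{\theta,b}_{X,E}}=\|t^{-\theta}b(t)E_X(f,t)\|_{\tilde E}<\infty$, and $B^{\theta,b}_{X,E}=\mathring B^{\theta,b}_{X,E}\cap X$ with $\|f\|_{B^{\theta,b}_{X,E}}=\|t^{-\theta}b(t)E_X(f,t)\|_{\tilde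 E(0,1)}+\|f\|_X$. *)

theory Defs
  imports "HOL-Analysis.Analysis" "HOL-Probability.Essential_Supremum"
begin

section \<open>RD-spaces\<close>

definition metric_measure_space :: "'a::metric_space measure \<Rightarrow> bool" where
  "metric_measure_space M \<longleftrightarrow>
     sets M = sets borel \<and>
     (\<forall>x r. r > 0 \<longrightarrow> 0 < emeasure M (ball x r) \<and> emeasure M (ball x r) < top) \<and>
     (\<forall>x. emeasure M {x} = 0)"

definition rd_space :: "real \<Rightarrow> real \<Rightarrow> 'a::metric_space measure \<Rightarrow> bool" where
  "rd_space k n M \<longleftrightarrow>
     metric_measure_space M \<and> 0 < k \<and> k \<le> n \<and>
     (\<exists>C1 C2. 0 < C1 \<and> C1 \<le> 1 \<and> 1 \<le> C2 \<and>
       (\<forall>x r l. 0 < r \<longrightarrow> 1 \<le> l \<longrightarrow>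
          C1 * l powr k * measure M (ball x r) \<le> measure M (ball x (l * r)) \<and>
          measure M (ball x (l * r)) \<le> C2 * l powr n * measure M (ball x r)))"


section \<open>Rearrangement invariant spaces\<close>

text \<open>A Banach function space is represented by its function norm \<open>\<rho>\<close>, which acts on the
  measurable functions with values in \<open>[0, \<infinity>]\<close>; the axioms are those of Bennett and Sharpley
  and include the Fatou property.  No condition is put on the values of \<open>\<rho>\<close> at
  non-measurable functions.\<close>

definition banach_function_norm :: "'a measure \<Rightarrow> (('a \<Rightarrow> ennreal) \<Rightarrow> ennreal) \<Rightarrow> bool" where
  "banach_function_norm M \<rho> \<longleftrightarrow>
     (\<forall>f\<in>borel_measurable M. \<rho> f = 0 \<longleftrightarrow> (AE x in M. f x = 0)) \<and>
     (\<forall>f\<in>borel_measurable M. \<forall>c\<ge>0. \<rho> (\<lambda>x. ennreal c * f x) = ennreal c * \<rho> f) \<and>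
     (\<forall>f\<in>borel_measurable M. \<forall>g\<in>borel_measurable M. \<rho> (\<lambda>x. f x + g x) \<le> \<rho> f + \<rho> g) \<and>
     (\<forall>f\<in>borel_measurable M. \<forall>g\<in>borel_measurable M. (AE x in M. g x \<le> f x) \<longrightarrow> \<rho> g \<le> \<rho> f) \<and>
     (\<forall>u. \<forall>f\<in>borel_measurable M. (\<forall>i::nat. u i \<in> borel_measurable M) \<longrightarrow>
        (\<forall>i. AE x in M. u i x \<le> u (Suc i) x) \<longrightarrow> (AE x in M. f x = (SUP i. u i x)) \<longrightarrow>
        \<rho> f = (SUP i. \<rho> (u i))) \<and>
     (\<forall>A\<in>sets M. emeasure M A < top \<longrightarrow> \<rho> (indicator A) < top) \<and>
     (\<forall>A\<in>sets M. emeasure M A < top \<longrightarrow>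
        (\<exists>C::real. C > 0 \<and>
           (\<forall>f\<in>borel_measurable M. (\<integral>\<^sup>+x\<in>A. f x \<partial>M) \<le> ennreal C * \<rho> f)))"

definition decreasing_rearrangement :: "'a measure \<Rightarrow> ('a \<Rightarrow> ennreal) \<Rightarrow> real \<Rightarrow> ennreal" where
  "decreasing_rearrangement M f s = Inf {t. emeasure M {x \<in> space M. t < f x} \<le> ennreal s}"

definition ri_norm :: "'a measure \<Rightarrow> (('a \<Rightarrow> ennreal) \<Rightarrow> ennreal) \<Rightarrow> bool" where
  "ri_norm M \<rho> \<longleftrightarrow>
     banach_function_norm M \<rho> \<and>
     (\<forall>f\<in>borel_measurable M. \<forall>g\<in>borel_measurable M.
        (AE s in lebesgue_on {0<..}.
           decreasing_rearrangement M f s \<le> decreasing_rearrangement M g s) \<longrightarrow>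
        \<rho> f \<le> \<rho> g)"

text \<open>The norm of a real function in the space given by \<open>\<rho>\<close>; the space itself consists of
  the functions of finite norm.\<close>

definition space_norm ::
  "'a measure \<Rightarrow> (('a \<Rightarrow> ennreal) \<Rightarrow> ennreal) \<Rightarrow> ('a \<Rightarrow> real) \<Rightarrow> ennreal" where
  "space_norm M \<rho> f = (if f \<in> borel_measurable M then \<rho> (\<lambda>x. ennreal \<bar>f x\<bar>) else top)"

definition L1_norm :: "'a measure \<Rightarrow> ('a \<Rightarrow> real) \<Rightarrow> ennreal" where
  "L1_norm M = space_norm M (nn_integral M)"

definition Linf_norm :: "'a measure \<Rightarrow> ('a \<Rightarrow> real) \<Rightarrow> ennreal" where
  "Linf_norm M = space_norm M (esssup M)"

definition ennreal_powr :: "ennreal \<Rightarrow> real \<Rightarrow> ennreal" where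
  "ennreal_powr x p = (if x = top then top else ennreal (enn2real x powr p))"

definition convexification :: "real \<Rightarrow> (('a \<Rightarrow> ennreal) \<Rightarrow> ennreal) \<Rightarrow> ('a \<Rightarrow> ennreal) \<Rightarrow> ennreal" where
  "convexification p \<rho> f = ennreal_powr (\<rho> (\<lambda>x. ennreal_powr (f x) p)) (1 / p)"


section \<open>Interpolation functors\<close>

text \<open>A normed space of (classes of) real functions is given by an extended seminorm on all
  functions: its elements are the functions of finite seminorm, two of them being identified
  if their difference has seminorm 0.  For the two spaces of a Banach couple, the last
  condition of \<open>banach_couple\<close> says that both identifications agree with that of the sum
  space, so that both spaces embed continuously into the (Hausdorff) sum space.\<close>

definition ext_seminorm :: "(('a \<Rightarrow> real) \<Rightarrow> ennreal) \<Rightarrow> bool" where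
  "ext_seminorm N \<longleftrightarrow>
     (\<forall>c f. N (\<lambda>x. c * f x) = ennreal \<bar>c\<bar> * N f) \<and>
     (\<forall>f g. N (\<lambda>x. f x + g x) \<le> N f + N g)"

definition complete_seminorm :: "(('a \<Rightarrow> real) \<Rightarrow> ennreal) \<Rightarrow> bool" where
  "complete_seminorm N \<longleftrightarrow>
     ext_seminorm N \<and>
     (\<forall>u::nat \<Rightarrow> 'a \<Rightarrow> real. (\<forall>i. N (u i) < top) \<longrightarrow>
        (\<forall>e>0. \<exists>K. \<forall>i\<ge>K. \<forall>j\<ge>K. N (\<lambda>x. u i x - u j x) < e) \<longrightarrow>
        (\<exists>f. N f < top \<and> (\<lambda>i. N (\<lambda>x. u i x - f x)) \<longlonglongrightarrow> 0))"

definition sum_norm ::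
  "(('a \<Rightarrow> real) \<Rightarrow> ennreal) \<Rightarrow> (('a \<Rightarrow> real) \<Rightarrow> ennreal) \<Rightarrow> ('a \<Rightarrow> real) \<Rightarrow> ennreal" where
  "sum_norm A0 A1 f = (INF g. A0 g + A1 (\<lambda>x. f x - g x))"

definition inter_norm ::
  "(('a \<Rightarrow> real) \<Rightarrow> ennreal) \<Rightarrow> (('a \<Rightarrow> real) \<Rightarrow> ennreal) \<Rightarrow> ('a \<Rightarrow> real) \<Rightarrow> ennreal" where
  "inter_norm A0 A1 f = max (A0 f) (A1 f)"

definition banach_couple ::
  "(('a \<Rightarrow> real) \<Rightarrow> ennreal) \<Rightarrow> (('a \<Rightarrow> real) \<Rightarrow> ennreal) \<Rightarrow> bool" where
  "banach_couple A0 A1 \<longleftrightarrow>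
     complete_seminorm A0 \<and> complete_seminorm A1 \<and>
     (\<forall>f. sum_norm A0 A1 f = 0 \<longrightarrow> A0 f = 0 \<and> A1 f = 0)"

definition intermediate_space ::
  "(('a \<Rightarrow> real) \<Rightarrow> ennreal) \<Rightarrow> (('a \<Rightarrow> real) \<Rightarrow> ennreal) \<Rightarrow> (('a \<Rightarrow> real) \<Rightarrow> ennreal) \<Rightarrow> bool" where
  "intermediate_space A0 A1 N \<longleftrightarrow>
     complete_seminorm N \<and>
     (\<exists>c::real. c > 0 \<and> (\<forall>f. sum_norm A0 A1 f \<le> ennreal c * N f)) \<and>
     (\<exists>c::real. c > 0 \<and> (\<forall>f. N f \<le> ennreal c * inter_norm A0 A1 f))"

definition linear_on_norm ::
  "(('a \<Rightarrow> real) \<Rightarrow> ennreal) \<Rightarrow> (('a \<Rightarrow> real) \<Rightarrow> 'a \<Rightarrow> real) \<Rightarrow> bool" where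
  "linear_on_norm N T \<longleftrightarrow>
     (\<forall>f g. N f < top \<longrightarrow> N g < top \<longrightarrow> T (\<lambda>x. f x + g x) = (\<lambda>x. T f x + T g x)) \<and>
     (\<forall>c f. N f < top \<longrightarrow> T (\<lambda>x. c * f x) = (\<lambda>x. c * T f x))"

definition bounded_by ::
  "(('a \<Rightarrow> real) \<Rightarrow> ennreal) \<Rightarrow> (('a \<Rightarrow> real) \<Rightarrow> ennreal) \<Rightarrow> real \<Rightarrow> (('a \<Rightarrow> real) \<Rightarrow> 'a \<Rightarrow> real) \<Rightarrow> bool" where
  "bounded_by A B c T \<longleftrightarrow> (\<forall>f. A f < top \<longrightarrow> B (T f) \<le> ennreal c * A f)"

text \<open>Exactness is the norm inequality
  \<open>\<parallel>T\<parallel> \<le> max \<parallel>T\<parallel>\<^sub>0 \<parallel>T\<parallel>\<^sub>1\<close> for admissible operators between couples.  The functor acts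
  on the couples whose spaces consist of classes of real functions on the real line.\<close>

definition exact_interpolation_functor ::
  "(((real \<Rightarrow> real) \<Rightarrow> ennreal) \<Rightarrow> ((real \<Rightarrow> real) \<Rightarrow> ennreal) \<Rightarrow> (real \<Rightarrow> real) \<Rightarrow> ennreal) \<Rightarrow> bool" where
  "exact_interpolation_functor F \<longleftrightarrow>
     (\<forall>A0 A1. banach_couple A0 A1 \<longrightarrow> intermediate_space A0 A1 (F A0 A1)) \<and>
     (\<forall>A0 A1 B0 B1 T c0 c1.
        banach_couple A0 A1 \<longrightarrow> banach_couple B0 B1 \<longrightarrow> 0 \<le> c0 \<longrightarrow> 0 \<le> c1 \<longrightarrow>
        linear_on_norm (sum_norm A0 A1) T \<longrightarrow> bounded_by A0 B0 c0 T \<longrightarrow> bounded_by A1 B1 c1 T \<longrightarrow>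
        bounded_by (F A0 A1) (F B0 B1) (max c0 c1) T)"


section \<open>Parameters\<close>

abbreviation leb_pos :: "real measure" where
  "leb_pos \<equiv> lebesgue_on {0<..}"

definition haar_pos :: "real measure" where
  "haar_pos = density leb_pos (\<lambda>t. ennreal (1 / t))"

definition besov_parameter ::
  "(((real \<Rightarrow> real) \<Rightarrow> ennreal) \<Rightarrow> ((real \<Rightarrow> real) \<Rightarrow> ennreal) \<Rightarrow> (real \<Rightarrow> real) \<Rightarrow> ennreal) \<Rightarrow>
   ((real \<Rightarrow> ennreal) \<Rightarrow> ennreal) \<Rightarrow> bool" where
  "besov_parameter F E \<longleftrightarrow>
     ri_norm leb_pos E \<and> exact_interpolation_functor F \<and>
     space_norm leb_pos E = F (L1_norm leb_pos) (Linf_norm leb_pos)"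

text \<open>The space \<open>F(L\<^sup>1(dt/t), L\<^sup>\<infinity>)\<close>, as a function norm on functions with values in
  \<open>[0, \<infinity>]\<close>; functions that are infinite on a set of positive measure have infinite norm.\<close>

definition tilde_norm ::
  "(((real \<Rightarrow> real) \<Rightarrow> ennreal) \<Rightarrow> ((real \<Rightarrow> real) \<Rightarrow> ennreal) \<Rightarrow> (real \<Rightarrow> real) \<Rightarrow> ennreal) \<Rightarrow>
   (real \<Rightarrow> ennreal) \<Rightarrow> ennreal" where
  "tilde_norm F g =
     (if AE t in leb_pos. g t < top
      then F (L1_norm haar_pos) (Linf_norm leb_pos) (\<lambda>t. enn2real (g t)) else top)"

definition slowly_varying :: "(real \<Rightarrow> real) \<Rightarrow> bool" where
  "slowly_varying b \<longleftrightarrow>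
     b \<in> borel_measurable leb_pos \<and> (\<forall>t>0. b t > 0) \<and>
     (\<forall>\<epsilon>>0.
        (\<exists>g c C. mono_on {0<..} g \<and> 0 < c \<and> 0 < C \<and>
           (\<forall>t>0. c * g t \<le> t powr \<epsilon> * b t \<and> t powr \<epsilon> * b t \<le> C * g t)) \<and>
        (\<exists>g c C. antimono_on {0<..} g \<and> 0 < c \<and> 0 < C \<and>
           (\<forall>t>0. c * g t \<le> t powr (-\<epsilon>) * b t \<and> t powr (-\<epsilon>) * b t \<le> C * g t)))"


section \<open>Besov spaces\<close>

definition osc_modulus ::
  "'a::metric_space measure \<Rightarrow> (('a \<Rightarrow> ennreal) \<Rightarrow> ennreal) \<Rightarrow> ('a \<Rightarrow> real) \<Rightarrow> real \<Rightarrow> ennreal" where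
  "osc_modulus M X f t =
     X (\<lambda>x. (\<integral>\<^sup>+y\<in>ball x t. ennreal \<bar>f x - f y\<bar> \<partial>M) / emeasure M (ball x t))"

text \<open>In the Besov spaces, \<open>G\<close> is the function norm on \<open>(0, \<infinity>)\<close> with respect to \<open>dt/t\<close> that
  corresponds to the parameter: \<open>tilde_norm F\<close> for the parameter \<open>E = F(L\<^sup>1, L\<^sup>\<infinity>)\<close> and
  \<open>convexification p (tilde_norm F)\<close> for its \<open>p\<close>-convexification.\<close>

definition hom_besov_norm ::
  "'a::metric_space measure \<Rightarrow> (('a \<Rightarrow> ennreal) \<Rightarrow> ennreal) \<Rightarrow> ((real \<Rightarrow> ennreal) \<Rightarrow> ennreal) \<Rightarrow>
   real \<Rightarrow> (real \<Rightarrow> real) \<Rightarrow> ('a \<Rightarrow> real) \<Rightarrow> ennreal" where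
  "hom_besov_norm M X G \<theta> b f = G (\<lambda>t. ennreal (t powr (-\<theta>) * b t) * osc_modulus M X f t)"

definition hom_besov_space ::
  "'a::metric_space measure \<Rightarrow> (('a \<Rightarrow> ennreal) \<Rightarrow> ennreal) \<Rightarrow> ((real \<Rightarrow> ennreal) \<Rightarrow> ennreal) \<Rightarrow>
   real \<Rightarrow> (real \<Rightarrow> real) \<Rightarrow> ('a \<Rightarrow> real) set" where
  "hom_besov_space M X G \<theta> b =
     {f. sum_norm (L1_norm M) (Linf_norm M) f < top \<and> hom_besov_norm M X G \<theta> b f < top}"

definition besov_norm ::
  "'a::metric_space measure \<Rightarrow> (('a \<Rightarrow> ennreal) \<Rightarrow> ennreal) \<Rightarrow> ((real \<Rightarrow> ennreal) \<Rightarrow> ennreal) \<Rightarrow>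
   real \<Rightarrow> (real \<Rightarrow> real) \<Rightarrow> ('a \<Rightarrow> real) \<Rightarrow> ennreal" where
  "besov_norm M X G \<theta> b f =
     G (\<lambda>t. ennreal (t powr (-\<theta>) * b t) * osc_modulus M X f t * indicator {0<..<1} t) +
     space_norm M X f"

definition besov_space ::
  "'a::metric_space measure \<Rightarrow> (('a \<Rightarrow> ennreal) \<Rightarrow> ennreal) \<Rightarrow> ((real \<Rightarrow> ennreal) \<Rightarrow> ennreal) \<Rightarrow>
   real \<Rightarrow> (real \<Rightarrow> real) \<Rightarrow> ('a \<Rightarrow> real) set" where
  "besov_space M X G \<theta> b = hom_besov_space M X G \<theta> b \<inter> {f. space_norm M X f < top}"

end

theory Submission
  imports Defs
begin

text \<open>
  Write \<open>\<phi>(t) = t powr (-\<theta>) * b t * E\<^sub>X(f, t)\<close> and \<open>G\<close> for the norm of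
  \<open>F(L\<^sup>1(dt/t), L\<^sup>\<infinity>)\<close>.  Doubling of \<open>\<mu>\<close> and slow variation of \<open>b\<close> give
  \<open>\<phi>(s) \<le> D \<phi>(t)\<close> for \<open>s \<le> t \<le> 2s\<close>.  Functions \<open>\<ge> l\<close> on \<open>(s, 2s)\<close> have norm at least
  \<open>c l\<close> in \<open>L\<^sup>1(dt/t) + L\<^sup>\<infinity>\<close>, hence under \<open>G\<close>, so that \<open>\<phi>\<close> is bounded by a multiple of
  \<open>A = G(\<phi>\<^sup>p) powr (1/p)\<close>; then \<open>\<phi>\<^sup>q \<le> (C A) powr (q - p) * \<phi>\<^sup>p\<close> gives the homogeneous embedding.

  For the inhomogeneous spaces this bounds \<open>\<phi>\<close> only on \<open>(0, 1/2]\<close>.  For \<open>1/2 \<le> s \<le> 1\<close> one needs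
  \<open>E\<^sub>X(f, s) \<le> C (\<parallel>f\<parallel>\<^sub>X + E\<^sub>X(f, 1/2))\<close>.  The mean of \<open>|f|\<close> over \<open>B(x, s)\<close> is controlled by its
  means over boundedly many balls of radius 1/4, and on such a ball the mean is at most
  \<open>|f|\<close> plus the oscillation at scale 1/2.  Reverse doubling allows to cover the region
  influenced by a small ball with boundedly many sets that are not larger than it in measure, so
  that rearrangement invariance applies directly, without boundedness of averaging operators on
  \<open>X\<close>.
\<close>

section \<open>The couple of \<open>L\<^sup>1(dt/t)\<close> and \<open>L\<^sup>\<infinity>\<close>\<close>

lemma ext_seminorm_minus_commute:
  assumes "ext_seminorm N"
  shows "N (\<lambda>x. f x - g x) = N (\<lambda>x. g x - f x)"
  using conjunct1[OF assms[unfolded ext_seminorm_def], rule_format, of "-1" "\<lambda>x. f x - g x"]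
  by simp

lemma ext_seminorm_diff_triangle:
  assumes "ext_seminorm N"
  shows "N (\<lambda>x. f x - h x) \<le> N (\<lambda>x. f x - g x) + N (\<lambda>x. g x - h x)"
  using conjunct2[OF assms[unfolded ext_seminorm_def], rule_format,
      of "\<lambda>x. f x - g x" "\<lambda>x. g x - h x"]
  by simp

text \<open>These axioms isolate what the Riesz--Fischer argument uses and hold both for the
  integral and for the essential supremum, so that completeness is proved once for both spaces of
  the couple.\<close>

locale function_norm =
  fixes M :: "'a measure" and \<rho> :: "('a \<Rightarrow> ennreal) \<Rightarrow> ennreal"
  assumes cmult_le: "\<And>c f. f \<in> borel_measurable M \<Longrightarrow> c \<ge> 0 \<Longrightarrow>
      \<rho> (\<lambda>x. ennreal c * f x) \<le> ennreal c * \<rho> f"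
    and mono_AE: "\<And>f g. f \<in> borel_measurable M \<Longrightarrow> g \<in> borel_measurable M \<Longrightarrow>
      AE x in M. f x \<le> g x \<Longrightarrow> \<rho> f \<le> \<rho> g"
    and add_le: "\<And>f g. f \<in> borel_measurable M \<Longrightarrow> g \<in> borel_measurable M \<Longrightarrow>
      \<rho> (\<lambda>x. f x + g x) \<le> \<rho> f + \<rho> g"
    and countably_subadditive: "\<And>u :: nat \<Rightarrow> _. (\<And>i. u i \<in> borel_measurable M) \<Longrightarrow>
      \<rho> (\<lambda>x. \<Sum>i. u i x) \<le> (\<Sum>i. \<rho> (u i))"
    and AE_finite: "\<And>f. f \<in> borel_measurable M \<Longrightarrow> \<rho> f < top \<Longrightarrow> AE x in M. f x < top"
begin

text \<open>Applying the inequality a second time, with the factor \<open>1 / c\<close> and the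
  already scaled function, gives the converse.\<close>

lemma cmult:
  assumes "f \<in> borel_measurable M" "c > 0"
  shows "\<rho> (\<lambda>x. ennreal c * f x) = ennreal c * \<rho> f"
proof (rule antisym)
  show "\<rho> (\<lambda>x. ennreal c * f x) \<le> ennreal c * \<rho> f" using assms cmult_le by auto
  have "\<rho> f = \<rho> (\<lambda>x. ennreal (1 / c) * (ennreal c * f x))"
    using assms by (simp add: mult.assoc[symmetric] ennreal_mult[symmetric])
  also have "\<dots> \<le> ennreal (1 / c) * \<rho> (\<lambda>x. ennreal c * f x)"
    using assms by (intro cmult_le) auto
  finally have "ennreal (1 / (1 / c)) * \<rho> f \<le> ennreal c * (ennreal (1/c) * \<rho> (\<lambda>x. ennreal c * f x))"
    by (simp add: mult_left_mono)
  thus "ennreal c * \<rho> f \<le> \<rho> (\<lambda>x. ennreal c * f x)"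
    using assms by (simp add: mult.assoc[symmetric] ennreal_mult[symmetric])
qed

lemma ext_seminorm_space_norm: "ext_seminorm (space_norm M \<rho>)"
  unfolding ext_seminorm_def
proof (intro conjI allI)
  fix c :: real and f :: "'a \<Rightarrow> real"
  show "space_norm M \<rho> (\<lambda>x. c * f x) = ennreal \<bar>c\<bar> * space_norm M \<rho> f"
  proof (cases "c = 0")
    \<comment> \<open>The left side is the norm of the zero function; on the right, 0 * top = 0 also
      covers nonmeasurable \<open>f\<close>.\<close>
    case True
    have "\<rho> (\<lambda>x. ennreal 0 * 0) \<le> ennreal 0 * \<rho> (\<lambda>x. 0)"
      by (rule cmult_le) auto
    thus ?thesis using True by (simp add: space_norm_def)
  next
    case False
    show ?thesis
    proof (cases "f \<in> borel_measurable M")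
      case True
      have "\<rho> (\<lambda>x. ennreal \<bar>c\<bar> * ennreal \<bar>f x\<bar>) = ennreal \<bar>c\<bar> * \<rho> (\<lambda>x. ennreal \<bar>f x\<bar>)"
        using False True by (intro cmult) auto
      thus ?thesis using True by (simp add: space_norm_def abs_mult ennreal_mult)
    next
      case nm: False
      have "(\<lambda>x. c * f x) \<notin> borel_measurable M"
      proof
        assume "(\<lambda>x. c * f x) \<in> borel_measurable M"
        hence "(\<lambda>x. (1 / c) * (c * f x)) \<in> borel_measurable M" by measurable
        thus False using nm False by simp
      qed
      thus ?thesis using nm False by (simp add: space_norm_def ennreal_mult_top)
    qed
  qed
next
  fix f g :: "'a \<Rightarrow> real"
  show "space_norm M \<rho> (\<lambda>x. f x + g x) \<le> space_norm M \<rho> f + space_norm M \<rho> g"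
  proof (cases "f \<in> borel_measurable M \<and> g \<in> borel_measurable M")
    case True
    hence [measurable]: "f \<in> borel_measurable M" "g \<in> borel_measurable M" by auto
    have "\<rho> (\<lambda>x. ennreal \<bar>f x + g x\<bar>) \<le> \<rho> (\<lambda>x. ennreal \<bar>f x\<bar> + ennreal \<bar>g x\<bar>)"
      by (rule mono_AE) (auto simp: ennreal_plus[symmetric] simp del: ennreal_plus intro!: ennreal_leI)
    also have "\<dots> \<le> \<rho> (\<lambda>x. ennreal \<bar>f x\<bar>) + \<rho> (\<lambda>x. ennreal \<bar>g x\<bar>)"
      by (rule add_le) auto
    finally show ?thesis by (simp add: space_norm_def)
  next
    case False
    thus ?thesis by (auto simp: space_norm_def)
  qed
qed

text \<open>Riesz--Fischer: a subsequence with summable increments converges almost everywhere.\<close>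

lemma complete_space_norm: "complete_seminorm (space_norm M \<rho>)"
  unfolding complete_seminorm_def
proof (intro conjI allI impI)
  let ?N = "space_norm M \<rho>"
  show N: "ext_seminorm ?N" by (rule ext_seminorm_space_norm)
  fix u :: "nat \<Rightarrow> 'a \<Rightarrow> real"
  assume fin: "\<forall>i. ?N (u i) < top"
    and cauchy: "\<forall>e>0. \<exists>K. \<forall>i\<ge>K. \<forall>j\<ge>K. ?N (\<lambda>x. u i x - u j x) < e"
  have u[measurable]: "u i \<in> borel_measurable M" for i
    using fin[rule_format, of i] by (auto simp: space_norm_def split: if_splits)
  have "\<forall>m. \<exists>K. \<forall>i\<ge>K. \<forall>j\<ge>K. ?N (\<lambda>x. u i x - u j x) < ennreal ((1/2) ^ m)"
    using cauchy by (auto simp: ennreal_zero_less_one)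
  then obtain K where K: "\<And>m i j. i \<ge> K m \<Longrightarrow> j \<ge> K m \<Longrightarrow>
      ?N (\<lambda>x. u i x - u j x) < ennreal ((1/2) ^ m)"
    by metis
  \<comment> \<open>The index is at least \<open>K m\<close> and remains so for all later terms, so
    consecutive terms of \<open>v\<close> differ by less than (1/2)^m in norm.\<close>
  define v where "v m = u (\<Sum>l\<le>m. K l)" for m
  have vK: "?N (\<lambda>x. u i x - v m x) < ennreal ((1/2) ^ m)" if "i \<ge> K m" for i m
    unfolding v_def by (rule K) (use that in \<open>auto intro: member_le_sum\<close>)
  have [measurable]: "v m \<in> borel_measurable M" for m unfolding v_def by measurable
  define d where "d m x = \<bar>v (Suc m) x - v m x\<bar>" for m x
  have [measurable]: "d m \<in> borel_measurable M" for m unfolding d_def by measurable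
  have d: "\<rho> (\<lambda>x. ennreal (d m x)) \<le> ennreal ((1/2) ^ m)" for m
  proof -
    have "K m \<le> (\<Sum>l\<le>Suc m. K l)" by (rule member_le_sum) auto
    from vK[OF this] show ?thesis
      by (simp add: space_norm_def d_def v_def)
  qed
  have tail: "\<rho> (\<lambda>x. \<Sum>i. ennreal (d (i + m) x)) \<le> ennreal (2 * (1/2) ^ m)" for m
  proof -
    have sm: "(\<lambda>i. (1/2::real) ^ (i + m)) sums (2 * (1/2) ^ m)"
      using sums_mult2[OF geometric_sums[of "1/2::real"], of "(1/2)^m"] by (simp add: power_add)
    have "\<rho> (\<lambda>x. \<Sum>i. ennreal (d (i + m) x)) \<le> (\<Sum>i. \<rho> (\<lambda>x. ennreal (d (i + m) x)))"
      by (rule countably_subadditive) auto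
    also have "\<dots> \<le> (\<Sum>i. ennreal ((1/2) ^ (i + m)))"
      by (intro suminf_le d) auto
    also have "\<dots> = ennreal (2 * (1/2) ^ m)"
      using sm by (intro suminf_ennreal_eq) auto
    finally show ?thesis .
  qed
  have "AE x in M. (\<Sum>i. ennreal (d (i + 0) x)) < top"
    by (intro AE_finite le_less_trans[OF tail]) auto
  hence AE_sum: "AE x in M. summable (\<lambda>i. d i x)"
    by eventually_elim (auto simp: d_def intro!: summable_suminf_not_top)
  \<comment> \<open>On the null set where the sequence diverges, \<open>lim\<close> has some
    unspecified value; it is still measurable in \<open>x\<close>.\<close>
  define f where "f x = lim (\<lambda>m. v m x)" for x
  have [measurable]: "f \<in> borel_measurable M" unfolding f_def by measurable
  have AE_le: "AE x in M. \<forall>m. ennreal \<bar>v m x - f x\<bar> \<le> (\<Sum>i. ennreal (d (i + m) x))"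
    using AE_sum
  proof eventually_elim
    fix x assume s: "summable (\<lambda>i. d i x)"
    hence "summable (\<lambda>i. v (Suc i) x - v i x)"
      unfolding d_def by (rule summable_rabs_cancel)
    hence "convergent (\<lambda>m. (\<Sum>i<m. v (Suc i) x - v i x) + v 0 x)"
      using convergent_add[OF _ convergent_const] by (auto simp: summable_iff_convergent)
    moreover have "(\<Sum>i<m. v (Suc i) x - v i x) + v 0 x = v m x" for m
      using sum_lessThan_telescope[of "\<lambda>i. v i x" m] by simp
    ultimately have lim: "(\<lambda>m. v m x) \<longlonglongrightarrow> f x"
      by (simp add: f_def convergent_LIMSEQ_iff)
    show "\<forall>m. ennreal \<bar>v m x - f x\<bar> \<le> (\<Sum>i. ennreal (d (i + m) x))"
    proof
      fix m
      have "(\<lambda>i. v (i + m) x) \<longlonglongrightarrow> f x" using lim by (rule LIMSEQ_ignore_initial_segment)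
      from telescope_sums[OF this] have eq: "(\<Sum>i. v (Suc i + m) x - v (i + m) x) = f x - v m x"
        by (simp add: sums_iff)
      have sd: "summable (\<lambda>i. d (i + m) x)" using s by (rule summable_ignore_initial_segment)
      have "\<bar>f x - v m x\<bar> \<le> (\<Sum>i. d (i + m) x)"
        unfolding eq[symmetric] using summable_rabs[of "\<lambda>i. v (Suc i + m) x - v (i + m) x"] sd
        by (simp add: d_def)
      thus "ennreal \<bar>v m x - f x\<bar> \<le> (\<Sum>i. ennreal (d (i + m) x))"
        by (subst suminf_ennreal2[OF _ sd]) (auto simp: d_def abs_minus_commute intro!: ennreal_leI)
    qed
  qed
  have vf: "?N (\<lambda>x. v m x - f x) \<le> ennreal (2 * (1/2) ^ m)" for m
  proof -
    have "\<rho> (\<lambda>x. ennreal \<bar>v m x - f x\<bar>) \<le> \<rho> (\<lambda>x. \<Sum>i. ennreal (d (i + m) x))"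
      using AE_le by (intro mono_AE) auto
    with tail[of m] show ?thesis by (simp add: space_norm_def)
  qed
  show "\<exists>f. ?N f < top \<and> (\<lambda>i. ?N (\<lambda>x. u i x - f x)) \<longlonglongrightarrow> 0"
  proof (intro exI conjI)
    have "?N f = ?N (\<lambda>x. f x - 0)" by simp
    also have "\<dots> \<le> ?N (\<lambda>x. f x - v 0 x) + ?N (\<lambda>x. v 0 x - 0)"
      by (rule ext_seminorm_diff_triangle[OF N])
    also have "\<dots> < top"
      using vf[of 0] fin[rule_format, of "\<Sum>l\<le>0. K l"]
      by (auto simp: ext_seminorm_minus_commute[OF N, of f] v_def intro: le_less_trans)
    finally show "?N f < top" .
    show "(\<lambda>i. ?N (\<lambda>x. u i x - f x)) \<longlonglongrightarrow> 0"
    proof (rule order_tendstoI)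
      fix e :: ennreal assume "0 < e"
      then obtain e' where e': "0 < e'" "e' < e" using dense by blast
      then obtain r where r: "r > 0" "e' = ennreal r"
        by (cases e') auto
      obtain m where m: "(1/2::real) ^ m < r / 3"
        using real_arch_pow_inv[of "r/3" "1/2"] r by auto
      have "?N (\<lambda>x. u i x - f x) < e" if "i \<ge> K m" for i
      proof -
        have "?N (\<lambda>x. u i x - f x) \<le> ?N (\<lambda>x. u i x - v m x) + ?N (\<lambda>x. v m x - f x)"
          by (rule ext_seminorm_diff_triangle[OF N])
        also have "\<dots> \<le> ennreal ((1/2)^m) + ennreal (2 * (1/2) ^ m)"
          using vK[OF that] vf[of m] by (intro add_mono) auto
        also have "\<dots> = ennreal (3 * (1/2)^m)" by (simp add: ennreal_plus[symmetric] del: ennreal_plus)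
        also have "\<dots> \<le> e'" using m unfolding r(2) by (intro ennreal_leI) auto
        also note e'(2)
        finally show ?thesis .
      qed
      thus "\<forall>\<^sub>F i in sequentially. ?N (\<lambda>x. u i x - f x) < e"
        by (auto simp: eventually_sequentially)
    qed auto
  qed
qed

end

lemma function_norm_nn_integral: "function_norm M (nn_integral M)"
proof
  fix f :: "'a \<Rightarrow> ennreal" assume "f \<in> borel_measurable M" "integral\<^sup>N M f < top"
  thus "AE x in M. f x < top" using nn_integral_PInf_AE[of f M] by (simp add: less_top)
qed (auto simp: nn_integral_cmult nn_integral_add nn_integral_suminf intro: nn_integral_mono_AE)

lemma function_norm_esssup: "function_norm M (esssup M)"
proof
  fix c :: real and f :: "'a \<Rightarrow> ennreal"
  assume f[measurable]: "f \<in> borel_measurable M" and "c \<ge> 0"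
  have "AE x in M. ennreal c * f x \<le> ennreal c * esssup M f"
    using esssup_AE[of f M] by eventually_elim (auto intro: mult_left_mono)
  thus "esssup M (\<lambda>x. ennreal c * f x) \<le> ennreal c * esssup M f" by (intro esssup_I) auto
next
  fix f g :: "'a \<Rightarrow> ennreal"
  assume [measurable]: "f \<in> borel_measurable M" "g \<in> borel_measurable M"
  have "AE x in M. f x + g x \<le> esssup M f + esssup M g"
    using esssup_AE[of f M] esssup_AE[of g M] by eventually_elim (rule add_mono)
  thus "esssup M (\<lambda>x. f x + g x) \<le> esssup M f + esssup M g" by (intro esssup_I) auto
next
  fix u :: "nat \<Rightarrow> 'a \<Rightarrow> ennreal"
  assume [measurable]: "\<And>i. u i \<in> borel_measurable M"
  have "AE x in M. \<forall>i. u i x \<le> esssup M (u i)"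
    using esssup_AE by (subst AE_all_countable) auto
  hence "AE x in M. (\<Sum>i. u i x) \<le> (\<Sum>i. esssup M (u i))"
    by eventually_elim (auto intro: suminf_le)
  thus "esssup M (\<lambda>x. \<Sum>i. u i x) \<le> (\<Sum>i. esssup M (u i))" by (intro esssup_I) auto
next
  fix f :: "'a \<Rightarrow> ennreal" assume "f \<in> borel_measurable M" "esssup M f < top"
  thus "AE x in M. f x < top" using esssup_AE[of f M] by (auto elim: eventually_mono)
qed (auto intro: esssup_AE_mono)

section \<open>The measure dt/t and its couple\<close>

lemma space_haar_pos [simp]: "space haar_pos = {0<..}"
  by (simp add: haar_pos_def)

lemma sets_haar_pos [measurable_cong, simp]: "sets haar_pos = sets leb_pos"
  by (simp add: haar_pos_def)

lemma borel_measurable_leb_pos: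
  "f \<in> borel_measurable borel \<Longrightarrow> f \<in> borel_measurable leb_pos"
  by (intro measurable_restrict_space1 measurable_completion) simp

lemma borel_measurable_haar_pos_iff: "f \<in> borel_measurable haar_pos \<longleftrightarrow> f \<in> borel_measurable leb_pos"
  by (simp cong: measurable_cong_sets)

lemma haar_density_measurable [measurable]: "(\<lambda>t. ennreal (1 / t)) \<in> borel_measurable leb_pos"
  by (rule borel_measurable_leb_pos) simp

text \<open>The density 1/t is strictly positive on the half-line, so both measures have the same
  null sets. Hence \<open>Linf_norm\<close> may be taken over \<open>leb_pos\<close>.\<close>

lemma AE_haar_pos: "(AE t in haar_pos. P t) \<longleftrightarrow> (AE t in leb_pos. P t)"
  unfolding haar_pos_def by (subst AE_density) (auto intro!: AE_cong simp: ennreal_zero_less_one)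

text \<open>Completeness is Riesz--Fischer. For the separation condition, a function of sum norm 0
  splits into \<open>g\<close> of arbitrarily small integral and a remainder that is uniformly
  small; this forces it to vanish almost everywhere.\<close>

lemma banach_couple_haar: "banach_couple (L1_norm haar_pos) (Linf_norm leb_pos)"
  unfolding banach_couple_def
proof (intro conjI allI impI)
  show "complete_seminorm (L1_norm haar_pos)"
    unfolding L1_norm_def by (intro function_norm.complete_space_norm function_norm_nn_integral)
  show "complete_seminorm (Linf_norm leb_pos)"
    unfolding Linf_norm_def by (intro function_norm.complete_space_norm function_norm_esssup)
  fix f assume z: "sum_norm (L1_norm haar_pos) (Linf_norm leb_pos) f = 0"
  \<comment> \<open>A splitting of total norm below \<open>e\<close> bounds both parts by
    \<open>e\<close>. Finiteness of the norms also yields measurability, since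
    \<open>space_norm\<close> is top on nonmeasurable functions.\<close>
  have ex: "\<exists>g\<in>borel_measurable leb_pos. f \<in> borel_measurable leb_pos \<and>
      (\<integral>\<^sup>+t. ennreal \<bar>g t\<bar> \<partial>haar_pos) < ennreal e \<and> (AE t in leb_pos. \<bar>f t - g t\<bar> \<le> e)"
    if "e > 0" for e
  proof -
    have "sum_norm (L1_norm haar_pos) (Linf_norm leb_pos) f < ennreal e" using z that by simp
    then obtain g where g: "L1_norm haar_pos g + Linf_norm leb_pos (\<lambda>t. f t - g t) < ennreal e"
      unfolding sum_norm_def by (auto simp: INF_less_iff)
    have 1: "L1_norm haar_pos g < ennreal e" and 2: "Linf_norm leb_pos (\<lambda>t. f t - g t) < ennreal e"
      using g by (auto elim!: le_less_trans[rotated])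
    have m[measurable]: "g \<in> borel_measurable leb_pos"
      using 1 by (auto simp: L1_norm_def space_norm_def borel_measurable_haar_pos_iff split: if_splits)
    have m2[measurable]: "(\<lambda>t. f t - g t) \<in> borel_measurable leb_pos"
      using 2 by (auto simp: Linf_norm_def space_norm_def split: if_splits)
    have "(\<lambda>t. (f t - g t) + g t) \<in> borel_measurable leb_pos" by measurable
    hence m3: "f \<in> borel_measurable leb_pos" by simp
    have "AE t in leb_pos. ennreal \<bar>f t - g t\<bar> \<le> esssup leb_pos (\<lambda>t. ennreal \<bar>f t - g t\<bar>)"
      by (rule esssup_AE)
    hence "AE t in leb_pos. \<bar>f t - g t\<bar> \<le> e"
    proof eventually_elim
      fix t assume "ennreal \<bar>f t - g t\<bar> \<le> esssup leb_pos (\<lambda>t. ennreal \<bar>f t - g t\<bar>)"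
      also have "\<dots> < ennreal e" using 2 m2 by (simp add: Linf_norm_def space_norm_def)
      finally show "\<bar>f t - g t\<bar> \<le> e" by (simp add: ennreal_less_iff)
    qed
    thus ?thesis using m m3 1
      by (intro bexI[of _ g]) (auto simp: L1_norm_def space_norm_def borel_measurable_haar_pos_iff)
  qed
  have f[measurable]: "f \<in> borel_measurable leb_pos" using ex[of 1] by auto
  have AE_le: "AE t in haar_pos. \<bar>f t\<bar> \<le> d" if "d > 0" for d
  proof -
    \<comment> \<open>\<open>ennreal\<close> cuts negative numbers off at 0, so the integrand is the
      positive part of |f| - d. It is at most |g| once the uniform error is at most
      \<open>d\<close>, while the integral of |g| is below the independent bound
      \<open>e\<close>.\<close>
    have "(\<integral>\<^sup>+t. ennreal (\<bar>f t\<bar> - d) \<partial>haar_pos) \<le> 0 + ennreal e" if e: "e > 0" for e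
    proof -
      have "min d e > 0" using e \<open>d > 0\<close> by simp
      from ex[OF this] obtain g where g[measurable]: "g \<in> borel_measurable leb_pos"
        "(\<integral>\<^sup>+t. ennreal \<bar>g t\<bar> \<partial>haar_pos) < ennreal (min d e)"
        "AE t in leb_pos. \<bar>f t - g t\<bar> \<le> min d e" by blast
      have "(\<integral>\<^sup>+t. ennreal (\<bar>f t\<bar> - d) \<partial>haar_pos) \<le> (\<integral>\<^sup>+t. ennreal \<bar>g t\<bar> \<partial>haar_pos)"
        using g(3) unfolding AE_haar_pos[symmetric]
        by (intro nn_integral_mono_AE) (auto elim!: eventually_mono intro!: ennreal_leI)
      also have "\<dots> \<le> ennreal e"
        using g(2) by (intro less_imp_le[OF less_le_trans[OF g(2)]] ennreal_leI) auto
      finally show ?thesis by simp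
    qed
    hence "(\<integral>\<^sup>+t. ennreal (\<bar>f t\<bar> - d) \<partial>haar_pos) = 0"
      using ennreal_le_epsilon[of 0 "\<integral>\<^sup>+t. ennreal (\<bar>f t\<bar> - d) \<partial>haar_pos"] by auto
    thus ?thesis
      by (subst (asm) nn_integral_0_iff_AE) (auto simp: ennreal_eq_0_iff)
  qed
  have "AE t in haar_pos. \<forall>m. \<bar>f t\<bar> \<le> 1 / real (Suc m)"
    by (subst AE_all_countable) (auto intro!: AE_le simp del: of_nat_Suc)
  hence f0: "AE t in haar_pos. f t = 0"
  proof eventually_elim
    fix t assume a: "\<forall>m. \<bar>f t\<bar> \<le> 1 / real (Suc m)"
    show "f t = 0"
    proof (rule ccontr)
      assume "f t \<noteq> 0"
      then obtain m where "inverse (real (Suc m)) < \<bar>f t\<bar>" using reals_Archimedean[of "\<bar>f t\<bar>"] by auto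
      with a[rule_format, of m] show False by (simp add: inverse_eq_divide)
    qed
  qed
  have "(\<integral>\<^sup>+t. ennreal \<bar>f t\<bar> \<partial>haar_pos) = 0"
    using f0 by (subst nn_integral_0_iff_AE) (auto elim: eventually_mono)
  thus "L1_norm haar_pos f = 0"
    by (simp add: L1_norm_def space_norm_def borel_measurable_haar_pos_iff)
  have "esssup leb_pos (\<lambda>t. ennreal \<bar>f t\<bar>) \<le> 0"
    using f0 by (intro esssup_I) (auto simp: AE_haar_pos elim: eventually_mono)
  thus "Linf_norm leb_pos f = 0"
    by (simp add: Linf_norm_def space_norm_def)
qed

section \<open>Interpolation and convexification\<close>

abbreviation haar_functor ::
  "(((real \<Rightarrow> real) \<Rightarrow> ennreal) \<Rightarrow> ((real \<Rightarrow> real) \<Rightarrow> ennreal) \<Rightarrow> (real \<Rightarrow> real) \<Rightarrow> ennreal) \<Rightarrow>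
   (real \<Rightarrow> real) \<Rightarrow> ennreal" where
  "haar_functor F \<equiv> F (L1_norm haar_pos) (Linf_norm leb_pos)"

text \<open>Monotonicity of the function norm makes the multiplication a contraction. This supplies
  both endpoint bounds when exactness is applied to a multiplication operator.\<close>

lemma space_norm_mult_le:
  assumes "function_norm M \<rho>" "m \<in> borel_measurable M" "\<And>x. \<bar>m x\<bar> \<le> 1"
  shows "bounded_by (space_norm M \<rho>) (space_norm M \<rho>) 1 (\<lambda>u x. u x * m x)"
  unfolding bounded_by_def
proof (intro allI impI)
  fix f :: "'a \<Rightarrow> real" assume "space_norm M \<rho> f < top"
  hence [measurable]: "f \<in> borel_measurable M" by (auto simp: space_norm_def split: if_splits)
  note [measurable] = assms(2)
  have "\<rho> (\<lambda>x. ennreal \<bar>f x * m x\<bar>) \<le> \<rho> (\<lambda>x. ennreal \<bar>f x\<bar>)"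
    using assms(3)
    by (intro function_norm.mono_AE[OF assms(1)])
       (auto simp: abs_mult intro!: ennreal_leI mult_left_le)
  thus "space_norm M \<rho> (\<lambda>x. f x * m x) \<le> ennreal 1 * space_norm M \<rho> f"
    by (simp add: space_norm_def)
qed

context
  fixes F
  assumes F: "exact_interpolation_functor F"
begin

lemma haar_functor_intermediate:
  "intermediate_space (L1_norm haar_pos) (Linf_norm leb_pos) (haar_functor F)"
  using F banach_couple_haar unfolding exact_interpolation_functor_def by blast

lemma haar_functor_seminorm: "ext_seminorm (haar_functor F)"
  using haar_functor_intermediate unfolding intermediate_space_def complete_seminorm_def by blast

text \<open>The lattice property comes from exactness, applied to the multiplication by \<open>f / g\<close>.\<close>

lemma haar_functor_mono:
  assumes f[measurable]: "f \<in> borel_measurable leb_pos" and g[measurable]: "g \<in> borel_measurable leb_pos"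
    and le: "AE t in leb_pos. \<bar>f t\<bar> \<le> \<bar>g t\<bar>"
  shows "haar_functor F f \<le> haar_functor F g"
proof (cases "haar_functor F g < top")
  case True
  \<comment> \<open>Where \<open>g\<close> and \<open>f\<close> both vanish, division by zero gives
    0. On the exceptional null set the value 0 keeps |m| \<le> 1 at every point.\<close>
  define m where "m t = (if \<bar>f t\<bar> \<le> \<bar>g t\<bar> then f t / g t else 0)" for t
  have m[measurable]: "m \<in> borel_measurable leb_pos" unfolding m_def by measurable
  have m1: "\<bar>m t\<bar> \<le> 1" for t
    by (cases "g t = 0") (auto simp: m_def abs_divide)
  define T where "T = (\<lambda>(u::real \<Rightarrow> real) t. u t * m t)"
  have "linear_on_norm (sum_norm (L1_norm haar_pos) (Linf_norm leb_pos)) T"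
    by (simp add: linear_on_norm_def T_def algebra_simps)
  moreover have "bounded_by (L1_norm haar_pos) (L1_norm haar_pos) 1 T"
    unfolding L1_norm_def T_def using m m1 function_norm_nn_integral
    by (intro space_norm_mult_le) (auto simp: borel_measurable_haar_pos_iff)
  moreover have "bounded_by (Linf_norm leb_pos) (Linf_norm leb_pos) 1 T"
    unfolding Linf_norm_def T_def using m m1 function_norm_esssup by (intro space_norm_mult_le)
  ultimately have "bounded_by (haar_functor F) (haar_functor F) (max 1 1) T"
    using F banach_couple_haar zero_le_one unfolding exact_interpolation_functor_def by blast
  hence Tg: "haar_functor F (T g) \<le> haar_functor F g"
    using True unfolding bounded_by_def by simp
  have AE0: "AE t in leb_pos. f t - T g t = 0"
    using le by eventually_elim (auto simp: T_def m_def)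
  have [measurable]: "T g \<in> borel_measurable leb_pos" unfolding T_def by measurable
  have "(\<integral>\<^sup>+t. ennreal \<bar>f t - T g t\<bar> \<partial>haar_pos) = 0"
    using AE0 by (subst nn_integral_0_iff_AE) (auto simp: AE_haar_pos elim: eventually_mono)
  moreover have "esssup leb_pos (\<lambda>t. ennreal \<bar>f t - T g t\<bar>) \<le> 0"
    using AE0 by (intro esssup_I) (auto elim: eventually_mono)
  ultimately have "inter_norm (L1_norm haar_pos) (Linf_norm leb_pos) (\<lambda>t. f t - T g t) = 0"
    by (simp add: inter_norm_def L1_norm_def Linf_norm_def space_norm_def borel_measurable_haar_pos_iff)
  \<comment> \<open>The functor acts on functions rather than classes, and \<open>f\<close> agrees
    with \<open>T g\<close> only almost everywhere. Their difference has intersection norm 0, hence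
    norm 0 under the functor.\<close>
  hence d0: "haar_functor F (\<lambda>t. f t - T g t) = 0"
    using haar_functor_intermediate unfolding intermediate_space_def
    by (metis mult_zero_right le_zero_eq)
  have "haar_functor F (\<lambda>t. f t - 0) \<le>
      haar_functor F (\<lambda>t. f t - T g t) + haar_functor F (\<lambda>t. T g t - 0)"
    by (rule ext_seminorm_diff_triangle[OF haar_functor_seminorm])
  thus ?thesis using d0 Tg by simp
qed (simp add: not_less top_unique)

section \<open>Lower bounds from the sum space\<close>

lemma emeasure_haar_pos_dyadic:
  assumes "s > 0"
  shows "ennreal (1/2) \<le> emeasure haar_pos {s<..<2 * s}" "emeasure haar_pos {s<..<2 * s} \<le> 1"
proof -
  have A[measurable]: "{s<..<2 * s} \<in> sets leb_pos"
    using assms by (auto simp: sets_restrict_space)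
  have em: "emeasure leb_pos {s<..<2 * s} = ennreal s"
    using assms by (subst emeasure_restrict_space) auto
  have eq: "emeasure haar_pos {s<..<2 * s} = (\<integral>\<^sup>+t. ennreal (1/t) * indicator {s<..<2 * s} t \<partial>leb_pos)"
    unfolding haar_pos_def by (subst emeasure_density) auto
  \<comment> \<open>The exact value is ln 2; it suffices that 1/t lies between 1/(2s) and 1/s on an
    interval of length \<open>s\<close>.\<close>
  have "ennreal (1/2) = ennreal (1 / (2 * s)) * emeasure leb_pos {s<..<2 * s}"
    using assms by (simp add: em ennreal_mult[symmetric])
  also have "\<dots> = (\<integral>\<^sup>+t. ennreal (1 / (2 * s)) * indicator {s<..<2 * s} t \<partial>leb_pos)"
    by (simp add: nn_integral_cmult_indicator)
  also have "\<dots> \<le> emeasure haar_pos {s<..<2 * s}"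
    unfolding eq using assms
    by (intro nn_integral_mono) (auto simp: frac_le intro!: ennreal_leI split: split_indicator)
  finally show "ennreal (1/2) \<le> emeasure haar_pos {s<..<2 * s}" .
  have "emeasure haar_pos {s<..<2 * s} \<le> (\<integral>\<^sup>+t. ennreal (1 / s) * indicator {s<..<2 * s} t \<partial>leb_pos)"
    unfolding eq using assms
    by (intro nn_integral_mono) (auto simp: frac_le intro!: ennreal_leI split: split_indicator)
  also have "\<dots> = ennreal (1 / s) * emeasure leb_pos {s<..<2 * s}"
    by (simp add: nn_integral_cmult_indicator)
  also have "\<dots> = 1"
    using assms by (simp add: em ennreal_mult[symmetric])
  finally show "emeasure haar_pos {s<..<2 * s} \<le> 1" .
qed

text \<open>The space embeds into the sum space. For any splitting g = h + (g - h), integrate l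
  \<le> |h| + sup |g - h| over (s, 2s), whose dt/t measure lies between 1/2 and 1. The sum norm is
  thus at least l/2, whence the factor 2 in the constant.\<close>

lemma haar_functor_lower_bound:
  obtains c where "c > 0"
    "\<And>g s l. g \<in> borel_measurable leb_pos \<Longrightarrow> s > 0 \<Longrightarrow> l \<ge> 0 \<Longrightarrow>
       (AE t in leb_pos. t \<in> {s<..<2 * s} \<longrightarrow> l \<le> \<bar>g t\<bar>) \<Longrightarrow> ennreal l \<le> ennreal c * haar_functor F g"
proof -
  obtain c where c: "c > 0" "\<And>f. sum_norm (L1_norm haar_pos) (Linf_norm leb_pos) f
      \<le> ennreal c * haar_functor F f"
    using haar_functor_intermediate unfolding intermediate_space_def by blast
  have "ennreal l \<le> ennreal (2 * c) * haar_functor F g"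
    if g[measurable]: "g \<in> borel_measurable leb_pos" and s: "s > 0" and l: "l \<ge> 0"
      and le: "AE t in leb_pos. t \<in> {s<..<2 * s} \<longrightarrow> l \<le> \<bar>g t\<bar>" for g s l
  proof -
    have A[measurable]: "{s<..<2 * s} \<in> sets leb_pos"
      using s by (auto simp: sets_restrict_space)
    have "ennreal (l / 2) \<le> sum_norm (L1_norm haar_pos) (Linf_norm leb_pos) g"
      unfolding sum_norm_def
    proof (rule INF_greatest)
      fix h :: "real \<Rightarrow> real"
      show "ennreal (l / 2) \<le> L1_norm haar_pos h + Linf_norm leb_pos (\<lambda>t. g t - h t)"
      proof (cases "h \<in> borel_measurable leb_pos")
        case True
        note [measurable] = True
        define e where "e = Linf_norm leb_pos (\<lambda>t. g t - h t)"
        have e: "AE t in leb_pos. ennreal \<bar>g t - h t\<bar> \<le> e"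
          unfolding e_def Linf_norm_def space_norm_def using esssup_AE by auto
        have "ennreal (l / 2) = ennreal l * ennreal (1 / 2)"
          using ennreal_mult[OF l, of "1 / 2"] by simp
        also have "\<dots> \<le> ennreal l * emeasure haar_pos {s<..<2 * s}"
          by (intro mult_left_mono emeasure_haar_pos_dyadic s) auto
        also have "\<dots> = (\<integral>\<^sup>+t. ennreal l * indicator {s<..<2 * s} t \<partial>haar_pos)"
          by (simp add: nn_integral_cmult_indicator)
        also have "\<dots> \<le> (\<integral>\<^sup>+t. ennreal \<bar>h t\<bar> + e * indicator {s<..<2 * s} t \<partial>haar_pos)"
        proof (rule nn_integral_mono_AE)
          show "AE t in haar_pos. ennreal l * indicator {s<..<2 * s} t
              \<le> ennreal \<bar>h t\<bar> + e * indicator {s<..<2 * s} t"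
            unfolding AE_haar_pos using e le
          proof eventually_elim
            fix t assume 1: "ennreal \<bar>g t - h t\<bar> \<le> e" and 2: "t \<in> {s<..<2 * s} \<longrightarrow> l \<le> \<bar>g t\<bar>"
            show "ennreal l * indicator {s<..<2 * s} t \<le> ennreal \<bar>h t\<bar> + e * indicator {s<..<2 * s} t"
            proof (cases "t \<in> {s<..<2 * s}")
              case True
              have "ennreal l \<le> ennreal (\<bar>h t\<bar> + \<bar>g t - h t\<bar>)" using 2 True by (intro ennreal_leI) auto
              also have "\<dots> \<le> ennreal \<bar>h t\<bar> + e" using 1 by (simp add: add_left_mono)
              finally show ?thesis using True by simp
            qed auto
          qed
        qed
        also have "\<dots> = (\<integral>\<^sup>+t. ennreal \<bar>h t\<bar> \<partial>haar_pos) + e * emeasure haar_pos {s<..<2 * s}"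
          by (subst nn_integral_add) (auto simp: borel_measurable_haar_pos_iff nn_integral_cmult_indicator)
        also have "\<dots> \<le> (\<integral>\<^sup>+t. ennreal \<bar>h t\<bar> \<partial>haar_pos) + e * 1"
          by (intro add_left_mono mult_left_mono emeasure_haar_pos_dyadic s) auto
        finally show ?thesis
          by (simp add: e_def L1_norm_def space_norm_def borel_measurable_haar_pos_iff)
      qed (simp add: L1_norm_def space_norm_def borel_measurable_haar_pos_iff)
    qed
    also have "\<dots> \<le> ennreal c * haar_functor F g" by (rule c)
    finally have "ennreal 2 * ennreal (l / 2) \<le> ennreal 2 * (ennreal c * haar_functor F g)"
      by (intro mult_left_mono) auto
    moreover have "ennreal 2 * ennreal (l / 2) = ennreal l"
      using l by (subst ennreal_mult[symmetric]) auto
    moreover have "ennreal 2 * ennreal c = ennreal (2 * c)"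
      using c(1) by (subst ennreal_mult) auto
    ultimately show ?thesis by (simp only: mult.assoc[symmetric])
  qed
  with c(1) show thesis by (intro that[of "2 * c"]) auto
qed

section \<open>Estimates for convexified norms\<close>

lemma enn2real_ennreal_powr: "enn2real (ennreal_powr x p) = enn2real x powr p"
  by (simp add: ennreal_powr_def)

lemma ennreal_powr_less_top_iff [simp]: "ennreal_powr x p < top \<longleftrightarrow> x < top"
  by (simp add: ennreal_powr_def less_top)

lemma convexification_tilde_eq:
  assumes "AE t in leb_pos. \<phi> t < top"
  shows "convexification p (tilde_norm F) \<phi> =
    ennreal_powr (haar_functor F (\<lambda>t. enn2real (\<phi> t) powr p)) (1 / p)"
  using assms by (simp add: convexification_def tilde_norm_def enn2real_ennreal_powr)

lemma convexification_tilde_finite: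
  assumes "convexification p (tilde_norm F) \<phi> < top"
  shows "AE t in leb_pos. \<phi> t < top"
  using assms by (auto simp: convexification_def tilde_norm_def split: if_splits)

text \<open>This is the lower bound for the functor applied to the p-th power of \<phi>, followed by
  a p-th root.\<close>

lemma convexification_lower_bound:
  assumes "p > 0"
  shows "\<exists>c>0. \<forall>\<phi>\<in>borel_measurable leb_pos. \<forall>s>0. \<forall>l. (\<forall>t\<in>{s<..<2 * s}. l \<le> \<phi> t) \<longrightarrow>
    l \<le> ennreal c * convexification p (tilde_norm F) \<phi>"
proof -
  obtain c where c: "c > 0"
    "\<And>g s l. g \<in> borel_measurable leb_pos \<Longrightarrow> s > 0 \<Longrightarrow> l \<ge> 0 \<Longrightarrow>
       (AE t in leb_pos. t \<in> {s<..<2 * s} \<longrightarrow> l \<le> \<bar>g t\<bar>) \<Longrightarrow> ennreal l \<le> ennreal c * haar_functor F g"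
    using haar_functor_lower_bound by blast
  have "l \<le> ennreal (c powr (1/p)) * convexification p (tilde_norm F) \<phi>"
    if \<phi>[measurable]: "\<phi> \<in> borel_measurable leb_pos" and s: "s > 0"
      and l: "\<And>t. t \<in> {s<..<2 * s} \<Longrightarrow> l \<le> \<phi> t" for \<phi> s l
  proof (cases "convexification p (tilde_norm F) \<phi> < top")
    case True
    note fin = convexification_tilde_finite[OF True]
    note eq = convexification_tilde_eq[OF fin, of p]
    define n where "n = enn2real (haar_functor F (\<lambda>t. enn2real (\<phi> t) powr p))"
    have n: "haar_functor F (\<lambda>t. enn2real (\<phi> t) powr p) = ennreal n"
      using True unfolding eq n_def by simp
    have n0: "n \<ge> 0" by (simp add: n_def)
    \<comment> \<open>A finite norm makes \<phi> finite almost everywhere, whereas an infinite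
      \<open>l\<close> would make it infinite on a set of positive measure.\<close>
    have "l < top"
    proof (rule ccontr)
      assume "\<not> l < top"
      hence "l = top" by (simp add: not_less top_unique)
      hence "AE t in leb_pos. t \<notin> {s<..<2 * s}"
        using fin l by (auto elim!: eventually_mono simp: top_unique)
      hence "emeasure haar_pos {s<..<2 * s} = 0"
        unfolding AE_haar_pos[symmetric] using s
        by (subst (asm) AE_iff_null_sets[symmetric]) (auto simp: sets_restrict_space)
      with emeasure_haar_pos_dyadic(1)[OF s] show False by (simp add: ennreal_eq_0_iff)
    qed
    then obtain r where r: "l = ennreal r" "r \<ge> 0" by (cases l) auto
    have "ennreal (r powr p) \<le> ennreal c * haar_functor F (\<lambda>t. enn2real (\<phi> t) powr p)"
    proof (rule c(2)[OF _ s])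
      show "AE t in leb_pos. t \<in> {s<..<2 * s} \<longrightarrow> r powr p \<le> \<bar>enn2real (\<phi> t) powr p\<bar>"
        using fin
      proof eventually_elim
        fix t assume "\<phi> t < top"
        thus "t \<in> {s<..<2 * s} \<longrightarrow> r powr p \<le> \<bar>enn2real (\<phi> t) powr p\<bar>"
          using l[of t] r assms enn2real_mono[of l "\<phi> t"] by (auto intro!: powr_mono2)
      qed
    qed auto
    hence "r powr p \<le> c * n"
      using n n0 c(1) by (simp add: ennreal_mult[symmetric])
    hence "(r powr p) powr (1/p) \<le> (c * n) powr (1/p)"
      using assms by (intro powr_mono2) auto
    hence "r \<le> c powr (1/p) * n powr (1/p)"
      using r assms c(1) n0 by (simp add: powr_powr powr_mult)
    hence "ennreal r \<le> ennreal (c powr (1/p)) * ennreal (n powr (1/p))"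
      by (simp add: ennreal_mult[symmetric])
    thus ?thesis using eq n r n0 by (simp add: ennreal_powr_def)
  next
    case False
    thus ?thesis using c(1) by (simp add: not_less top_unique ennreal_mult_top)
  qed
  with c(1) show ?thesis by (intro exI[of _ "c powr (1/p)"]) auto
qed

text \<open>\<open>S\<close> bounds both the function and its norm for the exponent
  \<open>p\<close>. Pointwise \<phi>^q \<le> S^(q-p) \<phi>^p, so monotonicity and homogeneity bound
  the norm of \<phi>^q by S^(q-p) S^p = S^q.\<close>

lemma convexification_le_of_bounded:
  assumes pq: "0 < p" "p < q" and \<phi>[measurable]: "\<phi> \<in> borel_measurable leb_pos"
    and S: "AE t in leb_pos. \<phi> t \<le> S" and A: "convexification p (tilde_norm F) \<phi> \<le> S"
  shows "convexification q (tilde_norm F) \<phi> \<le> S"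
proof (cases "S < top")
  case True
  then obtain r where r: "S = ennreal r" "r \<ge> 0" by (cases S) auto
  have fin: "AE t in leb_pos. \<phi> t < top"
    using S True by (auto elim!: eventually_mono)
  let ?N = "\<lambda>p. haar_functor F (\<lambda>t. enn2real (\<phi> t) powr p)"
  note eq = convexification_tilde_eq[OF fin]
  have "convexification p (tilde_norm F) \<phi> < top" using A True by (rule le_less_trans)
  hence Np: "?N p < top" unfolding eq by simp
  then obtain n where n: "?N p = ennreal n" "n \<ge> 0" by (cases "?N p") auto
  have "n powr (1/p) \<le> r"
    using A unfolding eq n r by (simp add: ennreal_powr_def r n)
  hence "(n powr (1/p)) powr p \<le> r powr p" using pq by (intro powr_mono2) auto
  hence nr: "n \<le> r powr p" using n pq by (simp add: powr_powr)
  have "?N q \<le> haar_functor F (\<lambda>t. r powr (q - p) * enn2real (\<phi> t) powr p)"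
  proof (rule haar_functor_mono)
    show "AE t in leb_pos. \<bar>enn2real (\<phi> t) powr q\<bar> \<le> \<bar>r powr (q - p) * enn2real (\<phi> t) powr p\<bar>"
      using S
    proof eventually_elim
      fix t assume "\<phi> t \<le> S"
      hence "enn2real (\<phi> t) \<le> r" using r enn2real_mono[of "\<phi> t" S] by auto
      hence "enn2real (\<phi> t) powr (q - p) * enn2real (\<phi> t) powr p \<le> r powr (q - p) * enn2real (\<phi> t) powr p"
        using pq by (intro mult_right_mono powr_mono2) auto
      thus "\<bar>enn2real (\<phi> t) powr q\<bar> \<le> \<bar>r powr (q - p) * enn2real (\<phi> t) powr p\<bar>"
        by (simp add: powr_add[symmetric])
    qed
  qed auto
  also have "\<dots> = ennreal \<bar>r powr (q - p)\<bar> * ?N p"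
    by (rule conjunct1[OF haar_functor_seminorm[unfolded ext_seminorm_def], rule_format])
  also have "\<dots> = ennreal (r powr (q - p) * n)" using n by (simp add: ennreal_mult[symmetric])
  also have "\<dots> \<le> ennreal (r powr (q - p) * r powr p)"
    using nr by (intro ennreal_leI mult_left_mono) auto
  also have "\<dots> = ennreal (r powr q)" by (simp add: powr_add[symmetric])
  finally have Nq: "?N q \<le> ennreal (r powr q)" .
  then obtain m where m: "?N q = ennreal m" "m \<ge> 0"
    by (cases "?N q") (auto simp: top_unique)
  have "m \<le> r powr q" using Nq m by simp
  hence "m powr (1/q) \<le> (r powr q) powr (1/q)" using m pq by (intro powr_mono2) auto
  hence "m powr (1/q) \<le> r" using pq r by (simp add: powr_powr)
  thus ?thesis unfolding eq m r by (simp add: ennreal_powr_def m r ennreal_leI)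
qed (simp add: not_less top_unique)

end

section \<open>Doubling metric measure spaces\<close>

text \<open>The set is a union of rational rays and of the set \<open>T\<close> of its points above
  all its rationals. \<open>T\<close> has at most one point: between two of them there would be a
  rational of \<open>S\<close>.\<close>

lemma lower_set_borel:
  fixes S :: "real set"
  assumes "\<And>s t. t \<in> S \<Longrightarrow> s \<le> t \<Longrightarrow> s \<in> S"
  shows "S \<in> sets borel"
proof -
  define T where "T = {t\<in>S. \<forall>q\<in>\<rat> \<inter> S. q < t}"
  have "\<not> t < t'" if "t \<in> T" "t' \<in> T" for t t'
  proof
    assume "t < t'"
    then obtain q where q: "q \<in> \<rat>" "t < q" "q < t'" using Rats_dense_in_real by blast
    moreover have "q \<in> S" using assms[of t' q] q that by (auto simp: T_def)
    ultimately have "q < t" using that(1) unfolding T_def by blast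
    with \<open>t < q\<close> show False by simp
  qed
  hence "T \<subseteq> {SOME t. t \<in> T}"
    by (metis someI singletonI subsetI linorder_neqE)
  hence "countable T" by (rule countable_subset) simp
  hence "T \<in> sets borel" by (rule sets.countable[rotated]) auto
  hence "(\<Union>q\<in>\<rat> \<inter> S. {..q}) \<union> T \<in> sets borel"
    by (intro sets.Un sets.countable_UN') (auto simp: countable_rat)
  also have "(\<Union>q\<in>\<rat> \<inter> S. {..q}) \<union> T = S"
  proof (intro equalityI subsetI)
    fix t assume t: "t \<in> S"
    show "t \<in> (\<Union>q\<in>\<rat> \<inter> S. {..q}) \<union> T"
    proof (cases "t \<in> T")
      case False
      then obtain q where "q \<in> \<rat> \<inter> S" "\<not> q < t" using t unfolding T_def by blast
      thus ?thesis by (intro UnI1 UN_I[of q]) auto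
    qed simp
  next
    fix t assume "t \<in> (\<Union>q\<in>\<rat> \<inter> S. {..q}) \<union> T"
    thus "t \<in> S" using assms unfolding T_def by blast
  qed
  finally show ?thesis .
qed

lemma borel_measurable_antimono_ennreal:
  fixes f :: "real \<Rightarrow> ennreal"
  assumes "antimono f"
  shows "f \<in> borel_measurable borel"
proof (rule borel_measurableI_greater)
  fix a
  show "{x \<in> space borel. a < f x} \<in> sets borel"
    using assms by (intro lower_set_borel) (auto dest: antimonoD intro: less_le_trans)
qed

section \<open>Separated sets and packing in doubling spaces\<close>

definition separated :: "real \<Rightarrow> 'a::metric_space set \<Rightarrow> bool" where
  "separated \<delta> Z \<longleftrightarrow> (\<forall>z\<in>Z. \<forall>w\<in>Z. z \<noteq> w \<longrightarrow> \<delta> \<le> dist z w)"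

lemma separated_subset: "separated \<delta> Z \<Longrightarrow> Y \<subseteq> Z \<Longrightarrow> separated \<delta> Y"
  unfolding separated_def by blast

text \<open>Zorn's lemma gives a separated set that is maximal under inclusion; a point at distance
  at least \<delta> from all its members could be added.\<close>

lemma maximal_separated_set:
  assumes "\<delta> > 0"
  obtains Z :: "'a::metric_space set" where "separated \<delta> Z" "\<And>x. \<exists>z\<in>Z. dist z x < \<delta>"
proof -
  have "\<exists>Z\<in>{Z::'a set. separated \<delta> Z}. \<forall>Y\<in>{Z. separated \<delta> Z}. Z \<subseteq> Y \<longrightarrow> Y = Z"
  proof (rule subset_Zorn')
    fix C :: "'a set set" assume C: "subset.chain {Z. separated \<delta> Z} C"
    show "\<Union>C \<in> {Z. separated \<delta> Z}"
      unfolding mem_Collect_eq separated_def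
    proof (intro ballI impI)
      fix z w assume "z \<in> \<Union>C" "w \<in> \<Union>C" "z \<noteq> w"
      then obtain A B where AB: "A \<in> C" "z \<in> A" "B \<in> C" "w \<in> B" by auto
      hence "A \<subseteq> B \<or> B \<subseteq> A" using C by (auto simp: subset.chain_def)
      moreover have "separated \<delta> A" "separated \<delta> B" using C AB by (auto simp: subset.chain_def)
      ultimately show "\<delta> \<le> dist z w" using AB \<open>z \<noteq> w\<close> unfolding separated_def by blast
    qed
  qed
  then obtain Z :: "'a set" where Z: "separated \<delta> Z" "\<And>Y. separated \<delta> Y \<Longrightarrow> Z \<subseteq> Y \<Longrightarrow> Y = Z"
    by blast
  have "\<exists>z\<in>Z. dist z x < \<delta>" for x
  proof (rule ccontr)
    assume n: "\<not> (\<exists>z\<in>Z. dist z x < \<delta>)"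
    hence "separated \<delta> (insert x Z)"
      using Z(1) unfolding separated_def by (auto simp: dist_commute not_less)
    hence "x \<in> Z" using Z(2)[of "insert x Z"] by blast
    with n assms show False by auto
  qed
  with Z(1) show thesis by (intro that)
qed

text \<open>The constants that \<open>rd_space\<close> quantifies existentially are fixed here, so
  that later bounds can name them.\<close>

locale doubling_space =
  fixes M :: "'a::metric_space measure" and k n C1 C2 :: real
  assumes sets_M [measurable_cong, simp]: "sets M = sets borel"
    and ball_pos: "\<And>x r. r > 0 \<Longrightarrow> 0 < emeasure M (ball x r)"
    and ball_fin: "\<And>x r. r > 0 \<Longrightarrow> emeasure M (ball x r) < top"
    and k: "0 < k" and C1: "0 < C1" and C2: "1 \<le> C2"
    and reverse_doubling: "\<And>x r l. 0 < r \<Longrightarrow> 1 \<le> l \<Longrightarrow>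
       C1 * l powr k * measure M (ball x r) \<le> measure M (ball x (l * r))"
    and doubling: "\<And>x r l. 0 < r \<Longrightarrow> 1 \<le> l \<Longrightarrow>
       measure M (ball x (l * r)) \<le> C2 * l powr n * measure M (ball x r)"
begin

lemma space_M [simp]: "space M = UNIV"
  using sets_eq_imp_space_eq[OF sets_M] by simp

lemma ball_sets_M [measurable]: "ball x r \<in> sets M"
  by simp

lemma emeasure_ball_eq: "emeasure M (ball x r) = ennreal (measure M (ball x r))"
proof (cases "r > 0")
  case True
  thus ?thesis using ball_fin[of r x] by (simp add: measure_def)
next
  case False
  hence "ball x r = {}" by (simp add: ball_empty)
  thus ?thesis by (metis emeasure_empty ennreal_0 measure_empty)
qed

text \<open>By the distance condition, \<open>ball x s\<close> lies in
  \<open>ball y (l * r)\<close>; this turns doubling into a comparison of balls with different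
  centres.\<close>

lemma emeasure_ball_le:
  assumes "0 < r" "1 \<le> l" "dist x y + s \<le> l * r"
  shows "emeasure M (ball x s) \<le> ennreal (C2 * l powr n) * emeasure M (ball y r)"
proof -
  have "ball x s \<subseteq> ball y (l * r)"
    using assms(3) by (auto simp: dist_commute) (smt (verit, best) dist_commute dist_triangle)
  hence "emeasure M (ball x s) \<le> emeasure M (ball y (l * r))" by (intro emeasure_mono) auto
  also have "\<dots> \<le> ennreal (C2 * l powr n * measure M (ball y r))"
    unfolding emeasure_ball_eq using assms by (intro ennreal_leI doubling) auto
  also have "\<dots> = ennreal (C2 * l powr n) * emeasure M (ball y r)"
    unfolding emeasure_ball_eq using C2 by (subst ennreal_mult) auto
  finally show ?thesis .
qed

text \<open>The balls of radius \<delta>/2 around \<open>Z\<close> are disjoint and lie in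
  \<open>ball x (2 * R)\<close>. That ball lies within distance 3R = (6R/\<delta>)(\<delta>/2) of
  each centre, so each small ball carries a fixed fraction of its measure.\<close>

lemma card_separated_le:
  fixes Z :: "'a set"
  assumes Z: "separated \<delta> Z" "finite Z" "Z \<subseteq> ball x R" and \<delta>: "0 < \<delta>" "\<delta> \<le> R"
  shows "real (card Z) \<le> C2 * (6 * R / \<delta>) powr n"
proof -
  let ?D = "C2 * (6 * R / \<delta>) powr n" and ?m = "measure M (ball x (2 * R))"
  have "of_nat (card Z) * emeasure M (ball x (2 * R)) = (\<Sum>z\<in>Z. emeasure M (ball x (2 * R)))"
    by simp
  also have "\<dots> \<le> (\<Sum>z\<in>Z. ennreal ?D * emeasure M (ball z (\<delta> / 2)))"
    using assms by (intro sum_mono emeasure_ball_le) (force simp: field_simps)+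
  also have "\<dots> = ennreal ?D * (\<Sum>z\<in>Z. emeasure M (ball z (\<delta> / 2)))"
    by (simp add: sum_distrib_left)
  also have "(\<Sum>z\<in>Z. emeasure M (ball z (\<delta> / 2))) = emeasure M (\<Union>z\<in>Z. ball z (\<delta> / 2))"
  proof (rule sum_emeasure)
    show "disjoint_family_on (\<lambda>z. ball z (\<delta> / 2)) Z"
      unfolding disjoint_family_on_def
    proof (intro ballI impI)
      fix z w assume "z \<in> Z" "w \<in> Z" "z \<noteq> w"
      hence "\<delta> \<le> dist z w" using Z(1) by (auto simp: separated_def)
      thus "ball z (\<delta> / 2) \<inter> ball w (\<delta> / 2) = {}"
        by (intro disjoint_ballI) auto
    qed
  qed (use Z in auto)
  also have "\<dots> \<le> emeasure M (ball x (2 * R))"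
  proof (intro emeasure_mono UN_least subsetI)
    fix z y assume "z \<in> Z" "y \<in> ball z (\<delta> / 2)"
    thus "y \<in> ball x (2 * R)"
      using Z(3) \<delta> dist_triangle[of x y z] by (force simp: dist_commute)
  qed auto
  finally have "of_nat (card Z) * emeasure M (ball x (2 * R)) \<le> ennreal ?D * emeasure M (ball x (2 * R))"
    by (simp add: mult_left_mono)
  hence "real (card Z) * ?m \<le> ?D * ?m"
    using C2 unfolding emeasure_ball_eq ennreal_of_nat_eq_real_of_nat
    by (simp add: ennreal_mult[symmetric])
  moreover have "?m > 0"
    using ball_pos[of "2 * R" x] \<delta> by (simp add: emeasure_ball_eq)
  ultimately show ?thesis by simp
qed

text \<open>The packing bound is uniform over all finite subsets, which excludes an infinite
  \<open>Z\<close>.\<close>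

lemma finite_separated:
  fixes Z :: "'a set"
  assumes "separated \<delta> Z" "Z \<subseteq> ball x R" "0 < \<delta>" "\<delta> \<le> R"
  shows "finite Z \<and> card Z \<le> nat \<lfloor>C2 * (6 * R / \<delta>) powr n\<rfloor>"
proof (rule finite_if_finite_subsets_card_bdd)
  fix Y assume Y: "Y \<subseteq> Z" "finite Y"
  have "real (card Y) \<le> C2 * (6 * R / \<delta>) powr n"
    using assms Y by (intro card_separated_le[of \<delta> Y x]) (auto intro: separated_subset)
  thus "card Y \<le> nat \<lfloor>C2 * (6 * R / \<delta>) powr n\<rfloor>" by linarith
qed

text \<open>Balls around one point exhaust the space, and each meets \<open>Z\<close> in a finite
  set. The radii start at \<delta> because the packing bound asks for \<delta> \<le> R.\<close>

lemma countable_separated: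
  fixes Z :: "'a set"
  assumes "separated \<delta> Z" "0 < \<delta>"
  shows "countable Z"
proof -
  fix x :: 'a
  have "Z = (\<Union>m::nat. Z \<inter> ball x (\<delta> + real m))"
  proof (intro equalityI subsetI)
    fix z assume "z \<in> Z"
    moreover obtain m :: nat where "dist x z < real m" using reals_Archimedean2 by blast
    ultimately show "z \<in> (\<Union>m::nat. Z \<inter> ball x (\<delta> + real m))" using assms by (auto intro!: exI[of _ m])
  qed auto
  moreover have "finite (Z \<inter> ball x (\<delta> + real m))" for m :: nat
    using assms finite_separated[of \<delta> "Z \<inter> ball x (\<delta> + real m)" x "\<delta> + real m"]
      separated_subset[of \<delta> Z "Z \<inter> ball x (\<delta> + real m)"] by auto
  hence "countable (\<Union>m::nat. Z \<inter> ball x (\<delta> + real m))"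
    by (intro countable_UN countableI_type countable_finite)
  ultimately show ?thesis by simp
qed

text \<open>Doubling implies separability: unite maximal separated sets for the scales
  1/(m+1).\<close>

lemma countable_dense:
  obtains D :: "'a set" where "countable D" "\<And>x e. e > 0 \<Longrightarrow> \<exists>z\<in>D. dist z x < e"
proof -
  have "\<exists>Z::'a set. separated (1 / real (Suc m)) Z \<and> (\<forall>x. \<exists>z\<in>Z. dist z x < 1 / real (Suc m))" for m
    by (rule maximal_separated_set[of "1 / real (Suc m)"]) auto
  then obtain Z :: "nat \<Rightarrow> 'a set" where Z: "\<And>m. separated (1 / real (Suc m)) (Z m)"
    "\<And>m x. \<exists>z\<in>Z m. dist z x < 1 / real (Suc m)" by metis
  have "countable (\<Union>m. Z m)"
    by (intro countable_UN countable_separated[OF Z(1)]) auto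
  moreover have "\<exists>z\<in>(\<Union>m. Z m). dist z x < e" if e: "e > 0" for x e
  proof -
    obtain m where "inverse (real (Suc m)) < e" using reals_Archimedean[OF e] by blast
    with Z(2)[of m x] show ?thesis by (auto simp: inverse_eq_divide intro: less_trans)
  qed
  ultimately show thesis by (rule that)
qed

section \<open>Sigma-finiteness and measurability of integrals over balls\<close>

sublocale sigma_finite_measure M
proof
  fix x :: 'a
  have "(\<Union>m::nat. ball x (real (Suc m))) = UNIV"
  proof (intro equalityI subsetI)
    fix y
    obtain m :: nat where "dist x y < real m" using reals_Archimedean2 by blast
    thus "y \<in> (\<Union>m::nat. ball x (real (Suc m)))" by (auto intro!: exI[of _ m])
  qed auto
  thus "\<exists>A. countable A \<and> A \<subseteq> sets M \<and> \<Union>A = space M \<and> (\<forall>a\<in>A. emeasure M a \<noteq> \<infinity>)"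
    using ball_fin[of "real (Suc _)" x]
    by (intro exI[of _ "range (\<lambda>m::nat. ball x (real (Suc m)))"]) (auto simp: less_top)
qed

text \<open>Separability allows the open set to be written as a countable union of rectangles, which
  puts it into the product sigma-algebra.\<close>

lemma dist_less_measurable: "{p. dist (fst p) (snd p) < t} \<in> sets (M \<Otimes>\<^sub>M M)"
proof -
  obtain D :: "'a set" where D: "countable D" "\<And>x e. e > 0 \<Longrightarrow> \<exists>z\<in>D. dist z x < e"
    using countable_dense by blast
  have "{p :: 'a \<times> 'a. dist (fst p) (snd p) < t} = (\<Union>z\<in>D. \<Union>q\<in>\<rat>. ball z q \<times> ball z (t - q))"
  proof (intro equalityI subsetI)
    fix p :: "'a \<times> 'a" assume p: "p \<in> {p. dist (fst p) (snd p) < t}"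
    \<comment> \<open>A third of the slack leaves room for a rational \<open>q\<close> between e and
      2e: the first point is then within \<open>q\<close> of \<open>z\<close>, and the second within
      t - q.\<close>
    define e where "e = (t - dist (fst p) (snd p)) / 3"
    have "e > 0" using p by (simp add: e_def)
    obtain z where z: "z \<in> D" "dist z (fst p) < e" using D(2) \<open>e > 0\<close> by blast
    obtain q where q: "q \<in> \<rat>" "e < q" "q < 2 * e"
      using Rats_dense_in_real[of e "2 * e"] \<open>e > 0\<close> by auto
    have "dist z (snd p) < e + dist (fst p) (snd p)"
      using z dist_triangle[of z "snd p" "fst p"] by linarith
    also have "\<dots> < t - q" using q(3) by (simp add: e_def field_simps)
    finally show "p \<in> (\<Union>z\<in>D. \<Union>q\<in>\<rat>. ball z q \<times> ball z (t - q))"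
      using z q by (auto simp: mem_Times_iff intro!: bexI[of _ z] bexI[of _ q])
  next
    fix p assume "p \<in> (\<Union>z\<in>D. \<Union>q\<in>\<rat>. ball z q \<times> ball z (t - q))"
    then obtain z q where "dist z (fst p) < q" "dist z (snd p) < t - q"
      by (auto simp: mem_Times_iff)
    thus "p \<in> {p. dist (fst p) (snd p) < t}"
      using dist_triangle3[of "fst p" "snd p" z] by (simp add: dist_commute)
  qed
  also have "\<dots> \<in> sets (M \<Otimes>\<^sub>M M)"
    using D(1) by (intro sets.countable_UN'' countable_rat pair_measureI) auto
  finally show ?thesis .
qed

lemma ball_integral_measurable [measurable]:
  assumes "case_prod g \<in> borel_measurable (M \<Otimes>\<^sub>M M)"
  shows "(\<lambda>x. \<integral>\<^sup>+y\<in>ball x t. g x y \<partial>M) \<in> borel_measurable M"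
proof (rule borel_measurable_nn_integral)
  note [measurable] = dist_less_measurable[of t]
  have "(\<lambda>p. case_prod g p * indicator {p. dist (fst p) (snd p) < t} p) \<in> borel_measurable (M \<Otimes>\<^sub>M M)"
    using assms by measurable
  also have "(\<lambda>p. case_prod g p * indicator {p. dist (fst p) (snd p) < t} p)
      = (\<lambda>(x, y). g x y * indicator (ball x t) y)"
    by (auto simp: fun_eq_iff split: split_indicator)
  finally show "(\<lambda>(x, y). g x y * indicator (ball x t) y) \<in> borel_measurable (M \<Otimes>\<^sub>M M)" .
qed

lemma emeasure_ball_measurable [measurable]: "(\<lambda>x. emeasure M (ball x t)) \<in> borel_measurable M"
  using ball_integral_measurable[of "\<lambda>_ _. 1" t] by simp

end

section \<open>The modulus of oscillation\<close>

lemma ennreal_divide_mono: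
  fixes a b c d :: ennreal
  assumes "a \<le> b" "d \<le> c"
  shows "a / c \<le> b / d"
proof -
  have "inverse c \<le> inverse d"
    using assms(2) including ennreal.lifting by transfer (rule ereal_inverse_antimono)
  thus ?thesis unfolding divide_ennreal_def using assms(1) by (intro mult_mono) auto
qed

text \<open>Countable subadditivity for \<open>P\<close> meets countable additivity for the disjoint
  \<open>A\<close>. Numbers that enumerate no index get the empty set.\<close>

lemma emeasure_UN_le_UN:
  assumes I: "countable I" and [measurable]: "\<And>i. i \<in> I \<Longrightarrow> P i \<in> sets M" "\<And>i. i \<in> I \<Longrightarrow> A i \<in> sets M"
    and disj: "disjoint_family_on A I" and le: "\<And>i. i \<in> I \<Longrightarrow> emeasure M (P i) \<le> emeasure M (A i)"
  shows "emeasure M (\<Union>i\<in>I. P i) \<le> emeasure M (\<Union>i\<in>I. A i)"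
proof -
  define e where "e = from_nat_into I"
  define J where "J = to_nat_on I ` I"
  define P' where "P' j = (if j \<in> J then P (e j) else {})" for j
  define A' where "A' j = (if j \<in> J then A (e j) else {})" for j
  have e: "e j \<in> I" "to_nat_on I (e j) = j" if "j \<in> J" for j
    using that I by (auto simp: J_def e_def)
  have UN: "(\<Union>i\<in>I. Q i) = (\<Union>j. if j \<in> J then Q (e j) else {})" for Q :: "_ \<Rightarrow> 'b set"
    using e(1) I by (force simp: J_def e_def split: if_splits)
  have "emeasure M (\<Union>j. P' j) \<le> (\<Sum>j. emeasure M (P' j))"
    using e by (intro emeasure_subadditive_countably) (auto simp: P'_def)
  also have "\<dots> \<le> (\<Sum>j. emeasure M (A' j))"
    using e le by (intro suminf_le) (auto simp: P'_def A'_def)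
  also have "\<dots> = emeasure M (\<Union>j. A' j)"
  proof (rule suminf_emeasure)
    show "range A' \<subseteq> sets M" using e by (auto simp: A'_def)
    show "disjoint_family A'"
      unfolding disjoint_family_on_def
    proof (intro ballI impI)
      fix i j :: nat assume "i \<noteq> j"
      thus "A' i \<inter> A' j = {}"
        using disj e unfolding A'_def disjoint_family_on_def by (metis Int_empty_left Int_empty_right)
    qed
  qed
  finally show ?thesis unfolding UN P'_def A'_def .
qed

section \<open>Rearrangement invariant norms\<close>

locale ri_function_norm =
  fixes M :: "'a measure" and X :: "('a \<Rightarrow> ennreal) \<Rightarrow> ennreal"
  assumes ri: "ri_norm M X"
begin

lemma bfn: "banach_function_norm M X"
  using ri unfolding ri_norm_def by blast

lemma X_cmult: "f \<in> borel_measurable M \<Longrightarrow> c \<ge> 0 \<Longrightarrow> X (\<lambda>x. ennreal c * f x) = ennreal c * X f"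
  using bfn unfolding banach_function_norm_def by blast

lemma X_add: "f \<in> borel_measurable M \<Longrightarrow> g \<in> borel_measurable M \<Longrightarrow> X (\<lambda>x. f x + g x) \<le> X f + X g"
  using bfn unfolding banach_function_norm_def by blast

lemma X_mono:
  assumes "f \<in> borel_measurable M" "g \<in> borel_measurable M" "\<And>x. x \<in> space M \<Longrightarrow> f x \<le> g x"
  shows "X f \<le> X g"
  using bfn assms(1,2) AE_I2[of M "\<lambda>x. f x \<le> g x"] assms(3) unfolding banach_function_norm_def by blast

lemma X_SUP:
  assumes "\<And>i::nat. u i \<in> borel_measurable M" "\<And>i x. u i x \<le> u (Suc i) x"
  shows "X (\<lambda>x. SUP i. u i x) = (SUP i. X (u i))"
proof -
  have "(\<lambda>x. SUP i. u i x) \<in> borel_measurable M" using assms(1) by measurable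
  moreover have "\<forall>u. \<forall>f\<in>borel_measurable M. (\<forall>i::nat. u i \<in> borel_measurable M) \<longrightarrow>
        (\<forall>i. AE x in M. u i x \<le> u (Suc i) x) \<longrightarrow> (AE x in M. f x = (SUP i. u i x)) \<longrightarrow>
        X f = (SUP i. X (u i))"
    using bfn unfolding banach_function_norm_def by blast
  ultimately show ?thesis using assms by auto
qed

lemma X_sum:
  assumes "\<And>i. i \<in> I \<Longrightarrow> u i \<in> borel_measurable M"
  shows "X (\<lambda>x. \<Sum>i\<in>I. u i x) \<le> (\<Sum>i\<in>I. X (u i))"
proof -
  have X0: "X (\<lambda>x. 0) = 0" using X_cmult[of "\<lambda>x. 0" 0] by simp
  show ?thesis
    using assms
  proof (induction I rule: infinite_finite_induct)
    case (insert i I)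
    have "X (\<lambda>x. u i x + (\<Sum>i\<in>I. u i x)) \<le> X (u i) + X (\<lambda>x. \<Sum>i\<in>I. u i x)"
      using insert by (intro X_add) auto
    also have "\<dots> \<le> X (u i) + (\<Sum>i\<in>I. X (u i))"
      using insert by (intro add_left_mono insert.IH) auto
    finally show ?case using insert by simp
  qed (simp_all add: X0)
qed

text \<open>A smaller distribution function enlarges the set whose infimum is the rearrangement.
  Rearrangement invariance is used in this form when functions on different sets are
  compared.\<close>

lemma X_mono_distribution:
  assumes "f \<in> borel_measurable M" "g \<in> borel_measurable M"
    and "\<And>t. emeasure M {x \<in> space M. t < f x} \<le> emeasure M {x \<in> space M. t < g x}"
  shows "X f \<le> X g"
proof -
  have "decreasing_rearrangement M f s \<le> decreasing_rearrangement M g s" for s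
    unfolding decreasing_rearrangement_def using assms(3) by (intro Inf_superset_mono) (auto intro: order_trans)
  thus ?thesis using ri assms(1,2) unfolding ri_norm_def by blast
qed

end

section \<open>Oscillation integrals and their dependence on the radius\<close>

locale ri_doubling_space = doubling_space M k n C1 C2 + ri_function_norm M X
  for M :: "'a::metric_space measure" and k n C1 C2 X
begin

text \<open>The integral is not divided by the measure of the ball: both increase with
  \<open>t\<close>, and they have to be estimated separately.\<close>

definition osc :: "('a \<Rightarrow> real) \<Rightarrow> real \<Rightarrow> 'a \<Rightarrow> ennreal" where
  "osc f t x = (\<integral>\<^sup>+y\<in>ball x t. ennreal \<bar>f x - f y\<bar> \<partial>M)"

lemma osc_modulus_eq: "osc_modulus M X f t = X (\<lambda>x. osc f t x / emeasure M (ball x t))"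
  by (simp add: osc_modulus_def osc_def)

lemma osc_measurable [measurable]:
  assumes [measurable]: "f \<in> borel_measurable M"
  shows "osc f t \<in> borel_measurable M"
  unfolding osc_def by measurable

lemma osc_mono: "s \<le> t \<Longrightarrow> osc f s x \<le> osc f t x"
  unfolding osc_def by (intro nn_integral_mono) (auto split: split_indicator)

text \<open>Open balls are increasing unions of the balls with radii t - 1/(m+1), so monotone
  convergence gives left continuity. Nonpositive radii give empty balls.\<close>

lemma osc_SUP:
  assumes [measurable]: "f \<in> borel_measurable M"
  shows "osc f t x = (SUP m. osc f (t - 1 / real (Suc m)) x)"
proof -
  let ?u = "\<lambda>m y. ennreal \<bar>f x - f y\<bar> * indicator (ball x (t - 1 / real (Suc m))) y"
  have "(SUP m. ?u m y) = ennreal \<bar>f x - f y\<bar> * indicator (ball x t) y" for y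
  proof -
    have "(SUP m. indicator (ball x (t - 1 / real (Suc m))) y :: ennreal) = indicator (ball x t) y"
    proof (cases "dist x y < t")
      case True
      then obtain m where m: "inverse (real (Suc m)) < t - dist x y"
        using reals_Archimedean[of "t - dist x y"] by auto
      have "(1::ennreal) \<le> indicator (ball x (t - 1 / real (Suc m))) y"
        using m by (simp add: inverse_eq_divide)
      thus ?thesis using True
        by (intro antisym SUP_least) (auto split: split_indicator intro: SUP_upper2)
    next
      case False
      have "y \<notin> ball x (t - 1 / real (Suc m))" for m
      proof
        assume "y \<in> ball x (t - 1 / real (Suc m))"
        moreover have "1 / real (Suc m) > 0" by simp
        ultimately show False using False unfolding mem_ball by linarith
      qed
      thus ?thesis using False by simp
    qed
    thus ?thesis by (simp add: SUP_mult_left_ennreal[symmetric])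
  qed
  hence "osc f t x = (\<integral>\<^sup>+y. (SUP m. ?u m y) \<partial>M)" by (simp add: osc_def)
  also have "\<dots> = (SUP m. integral\<^sup>N M (?u m))"
  proof (rule nn_integral_monotone_convergence_SUP)
    show "incseq ?u"
    proof (intro incseq_SucI le_funI)
      fix m y
      have "1 / real (Suc (Suc m)) \<le> 1 / real (Suc m)" by (intro divide_left_mono) auto
      thus "?u m y \<le> ?u (Suc m) y" by (auto split: split_indicator simp del: of_nat_Suc)
    qed
  qed measurable
  finally show ?thesis by (simp add: osc_def)
qed

text \<open>Freezing the radius \<open>r < t\<close> of the domain of integration makes the quotient decreasing
  in \<open>t\<close>; the Fatou property recovers the modulus as a countable supremum.\<close>

lemma osc_modulus_measurable [measurable]:
  assumes [measurable]: "f \<in> borel_measurable M"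
  shows "osc_modulus M X f \<in> borel_measurable borel"
proof -
  define G where "G r t = X (\<lambda>x. osc f r x / emeasure M (ball x t))" for r t
  have G_mono: "G r t \<le> G r' t'" if "r \<le> r'" "t' \<le> t" for r r' t t'
    unfolding G_def using that
    by (intro X_mono ennreal_divide_mono emeasure_mono osc_mono) (auto intro: subset_ball)
  have [measurable]: "G r \<in> borel_measurable borel" for r
    by (intro borel_measurable_antimono_ennreal antimonoI G_mono) auto
  \<comment> \<open>The indicator admits only q < t, for which \<open>G q t\<close> is at most the
    modulus \<open>G t t\<close>. Conversely, every radius t - 1/(m+1) lies below such a
    rational.\<close>
  have "osc_modulus M X f t = (SUP q\<in>\<rat>. G q t * indicator {q<..} t)" for t
  proof (rule antisym)
    have "osc_modulus M X f t = X (\<lambda>x. SUP m. osc f (t - 1 / real (Suc m)) x / emeasure M (ball x t))"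
      unfolding osc_modulus_eq SUP_divide_ennreal[symmetric] osc_SUP[OF assms, symmetric] ..
    also have "\<dots> = (SUP m. G (t - 1 / real (Suc m)) t)"
      unfolding G_def
    proof (rule X_SUP)
      fix m x
      have "1 / real (Suc (Suc m)) \<le> 1 / real (Suc m)" by (intro divide_left_mono) auto
      thus "osc f (t - 1 / real (Suc m)) x / emeasure M (ball x t)
          \<le> osc f (t - 1 / real (Suc (Suc m))) x / emeasure M (ball x t)"
        by (intro divide_right_mono_ennreal osc_mono) simp
    qed measurable
    also have "\<dots> \<le> (SUP q\<in>\<rat>. G q t * indicator {q<..} t)"
    proof (rule SUP_least)
      fix m
      obtain q where "q \<in> \<rat>" "t - 1 / real (Suc m) < q" "q < t"
        using Rats_dense_in_real[of "t - 1 / real (Suc m)" t] by auto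
      thus "G (t - 1 / real (Suc m)) t \<le> (SUP q\<in>\<rat>. G q t * indicator {q<..} t)"
        by (intro SUP_upper2[of q]) (auto intro: G_mono)
    qed
    finally show "osc_modulus M X f t \<le> (SUP q\<in>\<rat>. G q t * indicator {q<..} t)" .
    show "(SUP q\<in>\<rat>. G q t * indicator {q<..} t) \<le> osc_modulus M X f t"
      unfolding osc_modulus_eq G_def[symmetric]
      by (intro SUP_least) (auto split: split_indicator intro: G_mono)
  qed
  moreover have "(\<lambda>t. SUP q\<in>\<rat>. G q t * indicator {q<..} t) \<in> borel_measurable borel"
    by (intro borel_measurable_SUP countable_rat) auto
  ultimately show ?thesis by presburger
qed

text \<open>The integral grows with the radius, while doubling keeps the measures of the two balls
  comparable.\<close>

lemma osc_modulus_doubling: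
  assumes [measurable]: "f \<in> borel_measurable M" and st: "0 < s" "s \<le> t" "t \<le> 2 * s"
  shows "osc_modulus M X f s \<le> ennreal (C2 * 2 powr n) * osc_modulus M X f t"
proof -
  let ?D = "C2 * 2 powr n"
  have "osc_modulus M X f s \<le> X (\<lambda>x. ennreal ?D * (osc f t x / emeasure M (ball x t)))"
    unfolding osc_modulus_eq
  proof (rule X_mono)
    fix x
    have em: "emeasure M (ball x t) \<le> ennreal ?D * emeasure M (ball x s)"
      using st by (intro emeasure_ball_le) auto
    have t0: "t > 0" using st by simp
    note p = ball_pos[OF st(1), of x] ball_fin[OF st(1), of x] ball_pos[OF t0, of x] ball_fin[OF t0, of x]
    have "osc f s x \<le> osc f t x / emeasure M (ball x t) * emeasure M (ball x t)"
      using p osc_mono[of s t f x] st by (simp add: ennreal_divide_times)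
    also have "\<dots> \<le> osc f t x / emeasure M (ball x t) * (ennreal ?D * emeasure M (ball x s))"
      by (intro mult_left_mono em) auto
    finally show "osc f s x / emeasure M (ball x s) \<le> ennreal ?D * (osc f t x / emeasure M (ball x t))"
      using p by (intro divide_le_posI_ennreal) (auto simp: ac_simps)
  qed measurable
  also have "\<dots> = ennreal ?D * osc_modulus M X f t"
    unfolding osc_modulus_eq using C2 by (intro X_cmult) auto
  finally show ?thesis .
qed

end

section \<open>Covering balls by uniformly many small sets\<close>

context doubling_space
begin

text \<open>Reverse doubling makes the balls of a small radius uniformly small compared with
  \<open>ball z (1/8)\<close>; this replaces splitting sets by nonatomicity.\<close>

lemma cover_by_small_sets:
  obtains P :: "'a \<Rightarrow> nat \<Rightarrow> 'a set" and N :: nat where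
    "\<And>z. ball z 2 \<subseteq> (\<Union>l<N. P z l)" "\<And>z l. P z l \<in> sets M"
    "\<And>z l. emeasure M (P z l) \<le> emeasure M (ball z (1/8))"
proof -
  \<comment> \<open>The choice gives C1 * L^k \<ge> C2 * 32^n: shrinking the radius from 1 to 1/L
    gains enough to absorb the loss between a unit ball and \<open>ball z (1/8)\<close>. The maximum
    with 1 admits \<open>L\<close> in reverse doubling.\<close>
  define L where "L = max 1 ((C2 * 32 powr n / C1) powr (1 / k))"
  define \<rho> where "\<rho> = 1 / L"
  have L: "L \<ge> 1" by (simp add: L_def)
  have \<rho>: "0 < \<rho>" "\<rho> \<le> 1" "L * \<rho> = 1" using L by (auto simp: \<rho>_def)
  have "C2 * 32 powr n / C1 = ((C2 * 32 powr n / C1) powr (1 / k)) powr k"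
    using k C1 C2 by (simp add: powr_powr)
  also have "\<dots> \<le> L powr k" unfolding L_def using k by (intro powr_mono2) auto
  finally have LC: "C2 * 32 powr n \<le> C1 * L powr k" using C1 by (simp add: field_simps)
  have small: "emeasure M (ball w \<rho>) \<le> emeasure M (ball z (1/8))" if "dist z w < 3" for z w
  proof -
    have "C1 * L powr k * measure M (ball w \<rho>) \<le> measure M (ball w (L * \<rho>))"
      using \<rho> L by (intro reverse_doubling) auto
    also have "\<dots> = measure M (ball w 1)" using \<rho> by simp
    finally have 1: "C1 * L powr k * measure M (ball w \<rho>) \<le> measure M (ball w 1)" .
    \<comment> \<open>The factor 32 comes from 3 + 1 = 32 * (1/8): distance of the centres plus
      radius.\<close>
    have "emeasure M (ball w 1) \<le> ennreal (C2 * 32 powr n) * emeasure M (ball z (1/8))"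
      using that by (intro emeasure_ball_le) (auto simp: dist_commute)
    hence 2: "measure M (ball w 1) \<le> C2 * 32 powr n * measure M (ball z (1/8))"
      using C2 unfolding emeasure_ball_eq by (subst (asm) ennreal_mult[symmetric]) auto
    have "C1 * L powr k * measure M (ball w \<rho>) \<le> C1 * L powr k * measure M (ball z (1/8))"
      using 1 2 mult_right_mono[OF LC measure_nonneg[of M "ball z (1/8)"]] by linarith
    moreover have "C1 * L powr k > 0" using C1 L by simp
    ultimately have "measure M (ball w \<rho>) \<le> measure M (ball z (1/8))"
      by (simp only: mult_le_cancel_left_pos)
    thus ?thesis unfolding emeasure_ball_eq by (rule ennreal_leI)
  qed
  obtain W :: "'a set" where W: "separated \<rho> W" "\<And>x. \<exists>w\<in>W. dist w x < \<rho>"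
    using maximal_separated_set[OF \<rho>(1)] by blast
  \<comment> \<open>Since \<rho> \<le> 1, net points close to \<open>ball z 2\<close> lie in
    \<open>ball z 3\<close>; \<open>N\<close> is the packing bound there, the same for every
    centre.\<close>
  define N where "N = nat \<lfloor>C2 * (6 * 3 / \<rho>) powr n\<rfloor>"
  have fin: "finite (W \<inter> ball z 3) \<and> card (W \<inter> ball z 3) \<le> N" for z
    unfolding N_def using W \<rho> by (intro finite_separated[of \<rho> _ z]) (auto intro: separated_subset)
  hence "\<exists>e. bij_betw e {0..<card (W \<inter> ball z 3)} (W \<inter> ball z 3)" for z
    by (intro ex_bij_betw_nat_finite) auto
  then obtain e where e: "\<And>z. bij_betw (e z) {0..<card (W \<inter> ball z 3)} (W \<inter> ball z 3)"
    by metis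
  \<comment> \<open>Empty sets fill up the family, so that all \<open>z\<close> share the index
    range below \<open>N\<close>.\<close>
  define P where "P z l = (if l < card (W \<inter> ball z 3) then ball (e z l) \<rho> else {})" for z l
  have eW: "e z l \<in> W \<inter> ball z 3" if "l < card (W \<inter> ball z 3)" for z l
    using bij_betwE[OF e[of z]] that by auto
  show thesis
  proof (rule that[of P N])
    fix z
    show "ball z 2 \<subseteq> (\<Union>l<N. P z l)"
    proof
      fix x assume x: "x \<in> ball z 2"
      obtain w where w: "w \<in> W" "dist w x < \<rho>" using W(2) by blast
      have "w \<in> W \<inter> ball z 3"
        using x w \<rho>(2) dist_triangle[of z w x] by (auto simp: dist_commute)
      then obtain l where l: "l < card (W \<inter> ball z 3)" "w = e z l"
        using bij_betw_imp_surj_on[OF e[of z]] by (metis atLeastLessThan_iff imageE)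
      thus "x \<in> (\<Union>l<N. P z l)"
        using w fin[of z] by (intro UN_I[of l]) (auto simp: P_def)
    qed
    fix l
    show "P z l \<in> sets M" by (auto simp: P_def)
    show "emeasure M (P z l) \<le> emeasure M (ball z (1/8))"
      using eW[of l z] small[of z "e z l"] by (auto simp: P_def)
  qed
qed

end

section \<open>The modulus at scales between 1/2 and 1\<close>

context ri_doubling_space
begin

text \<open>For fixed \<open>l\<close>, the function \<open>h l\<close> carries the mean value \<open>a z\<close> over to the \<open>l\<close>-th
  covering set of \<open>z\<close>.  Its distribution function is at most that of \<open>g\<close>, because
  \<open>a z \<le> g\<close> on the disjoint balls \<open>ball z (1/8)\<close>.\<close>

lemma osc_modulus_le_unit_scale:
  obtains C where "C > 0"
    "\<And>f s. f \<in> borel_measurable M \<Longrightarrow> 1/2 \<le> s \<Longrightarrow> s \<le> 1 \<Longrightarrow>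
       osc_modulus M X f s \<le> ennreal C * (X (\<lambda>x. ennreal \<bar>f x\<bar>) + osc_modulus M X f (1/2))"
proof -
  obtain P :: "'a \<Rightarrow> nat \<Rightarrow> 'a set" and N :: nat where
    P: "\<And>z. ball z 2 \<subseteq> (\<Union>l<N. P z l)" "\<And>z l. P z l \<in> sets M"
      "\<And>z l. emeasure M (P z l) \<le> emeasure M (ball z (1/8))"
    by (rule cover_by_small_sets) (rule that)
  obtain Z :: "'a set" where Z: "separated (1/4) Z" "\<And>x. \<exists>z\<in>Z. dist z x < 1/4"
    by (rule maximal_separated_set[of "1/4"]) auto
  have cZ [simp]: "countable Z" using Z(1) by (rule countable_separated) auto
  define K where "K = nat \<lfloor>C2 * (6 * 2 / (1/4)) powr n\<rfloor>"
  have finZ: "finite (Z \<inter> ball x 2) \<and> card (Z \<inter> ball x 2) \<le> K" for x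
    unfolding K_def using separated_subset[OF Z(1)] by (intro finite_separated[of _ _ x]) auto
  \<comment> \<open>\<open>D4\<close> compares \<open>ball x (1/2)\<close> with
    \<open>ball z (1/4)\<close> for \<open>x\<close> within 1/8 of \<open>z\<close>, as 1/8 + 1/2
    \<le> 4/4. \<open>D6\<close> compares \<open>ball z (1/4)\<close> with \<open>ball x s\<close>
    for \<open>z\<close> within 2 of \<open>x\<close>, as 2 + 1/4 \<le> 6s.\<close>
  define D4 where "D4 = C2 * 4 powr n"
  define D6 where "D6 = C2 * 6 powr n"
  have D: "D4 \<ge> 0" "D6 \<ge> 0" using C2 by (auto simp: D4_def D6_def)
  \<comment> \<open>The summand 1 pays for |f x| itself. The mean of |f| costs \<open>D6\<close> for
    each of at most \<open>K\<close> net points and involves \<open>N\<close> functions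
    \<open>h l\<close>, each of norm at most that of \<open>g\<close>, which in turn costs 1 +
    D4.\<close>
  define C where "C = 1 + D6 * real K * real N * (1 + D4)"
  have bnd: "osc_modulus M X f s \<le> ennreal C * (X (\<lambda>x. ennreal \<bar>f x\<bar>) + osc_modulus M X f (1/2))"
    if f[measurable]: "f \<in> borel_measurable M" and s: "1/2 \<le> s" "s \<le> 1" for f s
  proof -
    define a where "a z = (\<integral>\<^sup>+y\<in>ball z (1/4). ennreal \<bar>f y\<bar> \<partial>M) / emeasure M (ball z (1/4))" for z
    define g where "g x = ennreal \<bar>f x\<bar> + ennreal D4 * (osc f (1/2) x / emeasure M (ball x (1/2)))" for x
    \<comment> \<open>A supremum instead of a sum makes each superlevel set a plain union of
      covering sets.\<close>
    define h where "h l x = (SUP z\<in>Z. a z * indicator (P z l) x)" for l x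
    have [measurable]: "g \<in> borel_measurable M" unfolding g_def by measurable
    note [measurable] = P(2)
    have [measurable]: "h l \<in> borel_measurable M" for l unfolding h_def by measurable
    note pos = ball_pos ball_fin

    \<comment> \<open>Use |f y| \<le> |f x| + |f x - f y| on \<open>ball z (1/4)\<close>, which lies
      in \<open>ball x (1/2)\<close>.\<close>
    have ag: "a z \<le> g x" if x: "x \<in> ball z (1/8)" for z x
    proof -
      let ?e = "emeasure M (ball z (1/4))"
      have p: "0 < ?e" "?e < top" "0 < emeasure M (ball x (1/2))" "emeasure M (ball x (1/2)) < top"
        using pos by auto
      have "(\<integral>\<^sup>+y\<in>ball z (1/4). ennreal \<bar>f y\<bar> \<partial>M)
          \<le> (\<integral>\<^sup>+y. ennreal \<bar>f x\<bar> * indicator (ball z (1/4)) y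
                + ennreal \<bar>f x - f y\<bar> * indicator (ball x (1/2)) y \<partial>M)"
      proof (rule nn_integral_mono)
        fix y
        have "y \<in> ball z (1/4) \<Longrightarrow> y \<in> ball x (1/2)"
          using x dist_triangle[of x y z] by (auto simp: dist_commute)
        moreover have "ennreal \<bar>f y\<bar> \<le> ennreal \<bar>f x\<bar> + ennreal \<bar>f x - f y\<bar>"
          by (subst ennreal_plus[symmetric]) (auto simp del: ennreal_plus intro!: ennreal_leI)
        ultimately show "ennreal \<bar>f y\<bar> * indicator (ball z (1/4)) y
            \<le> ennreal \<bar>f x\<bar> * indicator (ball z (1/4)) y
                + ennreal \<bar>f x - f y\<bar> * indicator (ball x (1/2)) y"
          by (auto split: split_indicator)
      qed
      also have "\<dots> = ennreal \<bar>f x\<bar> * ?e + osc f (1/2) x"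
        unfolding osc_def by (subst nn_integral_add) (auto simp: nn_integral_cmult_indicator)
      also have "osc f (1/2) x \<le> (osc f (1/2) x / emeasure M (ball x (1/2))) * emeasure M (ball x (1/2))"
        using p by (simp add: ennreal_divide_times)
      also have "\<dots> \<le> (osc f (1/2) x / emeasure M (ball x (1/2))) * (ennreal D4 * ?e)"
        unfolding D4_def using x by (intro mult_left_mono emeasure_ball_le) (auto simp: dist_commute)
      finally have "(\<integral>\<^sup>+y\<in>ball z (1/4). ennreal \<bar>f y\<bar> \<partial>M) \<le> ?e * g x"
        by (simp add: g_def algebra_simps add_left_mono)
      thus ?thesis unfolding a_def using p by (intro divide_le_posI_ennreal) auto
    qed

    have Xh: "X (h l) \<le> X g" for l
    proof (rule X_mono_distribution)
      fix t
      let ?I = "{z\<in>Z. t < a z}"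
      \<comment> \<open>Only net points with t < a z contribute; replacing their covering sets by
        the disjoint balls of radius 1/8 does not decrease the measure, and g > t on those
        balls.\<close>
      have "{x \<in> space M. t < h l x} = (\<Union>z\<in>?I. P z l)"
        unfolding h_def by (auto simp: less_SUP_iff split: split_indicator_asm split_indicator intro: le_less_trans)
      also have "emeasure M \<dots> \<le> emeasure M (\<Union>z\<in>?I. ball z (1/8))"
      proof (rule emeasure_UN_le_UN)
        show "countable ?I" by (rule countable_subset[OF _ cZ]) auto
        show "disjoint_family_on (\<lambda>z. ball z (1/8)) ?I"
          unfolding disjoint_family_on_def
        proof (intro ballI impI)
          fix z w assume "z \<in> ?I" "w \<in> ?I" "z \<noteq> w"
          hence "1/4 \<le> dist z w" using Z(1) by (auto simp: separated_def)
          thus "ball z (1/8) \<inter> ball w (1/8) = {}" by (intro disjoint_ballI) auto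
        qed
      qed (use P in auto)
      also have "\<dots> \<le> emeasure M {x \<in> space M. t < g x}"
        using ag by (intro emeasure_mono) (auto intro: less_le_trans)
      finally show "emeasure M {x \<in> space M. t < h l x} \<le> emeasure M {x \<in> space M. t < g x}" .
    qed measurable

    \<comment> \<open>The balls of radius 1/4 around the net points in \<open>ball x 2\<close> cover
      \<open>ball x s\<close>. For each such \<open>z\<close>, the point \<open>x\<close> lies in
      \<open>ball z 2\<close>, hence in some \<open>P z l\<close>, which gives a z \<le> h l
      x.\<close>
    have avg: "(\<integral>\<^sup>+y\<in>ball x s. ennreal \<bar>f y\<bar> \<partial>M) / emeasure M (ball x s)
        \<le> ennreal (D6 * real K) * (\<Sum>l<N. h l x)" for x
    proof -
      let ?Z = "Z \<inter> ball x 2" and ?e = "emeasure M (ball x s)"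
      have p: "0 < ?e" "?e < top" using pos[of s x] s by auto
      have ah: "a z \<le> (\<Sum>l<N. h l x)" if z: "z \<in> ?Z" for z
      proof -
        have "x \<in> ball z 2" using z by (simp add: dist_commute)
        then obtain l where l: "l < N" "x \<in> P z l" using P(1)[of z] by blast
        have "a z \<le> h l x"
          unfolding h_def using l z by (intro SUP_upper2[of z]) auto
        also have "\<dots> \<le> (\<Sum>l<N. h l x)" using l by (intro member_le_sum) auto
        finally show ?thesis .
      qed
      have "(\<integral>\<^sup>+y\<in>ball x s. ennreal \<bar>f y\<bar> \<partial>M)
          \<le> (\<integral>\<^sup>+y. (\<Sum>z\<in>?Z. ennreal \<bar>f y\<bar> * indicator (ball z (1/4)) y) \<partial>M)"
      proof (rule nn_integral_mono)
        fix y
        show "ennreal \<bar>f y\<bar> * indicator (ball x s) y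
            \<le> (\<Sum>z\<in>?Z. ennreal \<bar>f y\<bar> * indicator (ball z (1/4)) y)"
        proof (cases "y \<in> ball x s")
          case True
          obtain z where z: "z \<in> Z" "dist z y < 1/4" using Z(2) by blast
          have "z \<in> ?Z" using True s z dist_triangle[of x z y] by (auto simp: dist_commute)
          hence "ennreal \<bar>f y\<bar> * indicator (ball z (1/4)) y
              \<le> (\<Sum>z\<in>?Z. ennreal \<bar>f y\<bar> * indicator (ball z (1/4)) y)"
            using finZ by (intro member_le_sum) auto
          thus ?thesis using True z by simp
        qed simp
      qed
      also have "\<dots> = (\<Sum>z\<in>?Z. \<integral>\<^sup>+y\<in>ball z (1/4). ennreal \<bar>f y\<bar> \<partial>M)"
        by (rule nn_integral_sum) auto
      also have "\<dots> \<le> (\<Sum>z\<in>?Z. (\<Sum>l<N. h l x) * (ennreal D6 * ?e))"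
      proof (rule sum_mono)
        fix z assume z: "z \<in> ?Z"
        have q: "0 < emeasure M (ball z (1/4))" "emeasure M (ball z (1/4)) < top" using pos by auto
        hence "(\<integral>\<^sup>+y\<in>ball z (1/4). ennreal \<bar>f y\<bar> \<partial>M) \<le> a z * emeasure M (ball z (1/4))"
          unfolding a_def by (simp add: ennreal_divide_times)
        also have "\<dots> \<le> (\<Sum>l<N. h l x) * (ennreal D6 * ?e)"
          unfolding D6_def using z s by (intro mult_mono ah emeasure_ball_le) (auto simp: dist_commute)
        finally show "(\<integral>\<^sup>+y\<in>ball z (1/4). ennreal \<bar>f y\<bar> \<partial>M) \<le> (\<Sum>l<N. h l x) * (ennreal D6 * ?e)" .
      qed
      also have "\<dots> = of_nat (card ?Z) * ((\<Sum>l<N. h l x) * (ennreal D6 * ?e))" by simp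
      also have "\<dots> \<le> of_nat K * ((\<Sum>l<N. h l x) * (ennreal D6 * ?e))"
        using finZ[of x] by (intro mult_right_mono) auto
      also have "\<dots> = ?e * (ennreal (D6 * real K) * (\<Sum>l<N. h l x))"
        using D by (simp add: ennreal_mult ennreal_of_nat_eq_real_of_nat ac_simps)
      finally show ?thesis using p by (intro divide_le_posI_ennreal) auto
    qed

    have Xg: "X g \<le> X (\<lambda>x. ennreal \<bar>f x\<bar>) + ennreal D4 * osc_modulus M X f (1/2)"
      unfolding g_def osc_modulus_eq
    proof (subst X_cmult[symmetric])
      show "X (\<lambda>x. ennreal \<bar>f x\<bar> + ennreal D4 * (osc f (1/2) x / emeasure M (ball x (1/2))))
          \<le> X (\<lambda>x. ennreal \<bar>f x\<bar>)
            + X (\<lambda>x. ennreal D4 * (osc f (1/2) x / emeasure M (ball x (1/2))))"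
        by (rule X_add) measurable
    qed (use D in measurable)
    have "osc_modulus M X f s \<le> X (\<lambda>x. ennreal \<bar>f x\<bar> + ennreal (D6 * real K) * (\<Sum>l<N. h l x))"
      unfolding osc_modulus_eq
    proof (rule X_mono)
      fix x
      let ?e = "emeasure M (ball x s)"
      have p: "0 < ?e" "?e < top" using pos[of s x] s by auto
      have "osc f s x \<le> (\<integral>\<^sup>+y. ennreal \<bar>f x\<bar> * indicator (ball x s) y
                + ennreal \<bar>f y\<bar> * indicator (ball x s) y \<partial>M)"
        unfolding osc_def
      proof (rule nn_integral_mono)
        fix y
        have "ennreal \<bar>f x - f y\<bar> \<le> ennreal \<bar>f x\<bar> + ennreal \<bar>f y\<bar>"
          by (subst ennreal_plus[symmetric]) (auto simp del: ennreal_plus intro!: ennreal_leI)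
        thus "ennreal \<bar>f x - f y\<bar> * indicator (ball x s) y \<le> ennreal \<bar>f x\<bar> * indicator (ball x s) y
                + ennreal \<bar>f y\<bar> * indicator (ball x s) y"
          by (auto split: split_indicator)
      qed
      also have "\<dots> = ennreal \<bar>f x\<bar> * ?e + (\<integral>\<^sup>+y\<in>ball x s. ennreal \<bar>f y\<bar> \<partial>M)"
        by (subst nn_integral_add) (auto simp: nn_integral_cmult_indicator)
      finally have "osc f s x / ?e
          \<le> (ennreal \<bar>f x\<bar> * ?e + (\<integral>\<^sup>+y\<in>ball x s. ennreal \<bar>f y\<bar> \<partial>M)) / ?e"
        by (rule divide_right_mono_ennreal)
      also have "\<dots> = ennreal \<bar>f x\<bar> + (\<integral>\<^sup>+y\<in>ball x s. ennreal \<bar>f y\<bar> \<partial>M) / ?e"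
        using p by (simp add: divide_ennreal_def distrib_right mult.assoc)
           (simp add: divide_ennreal_def[symmetric])
      also have "\<dots> \<le> ennreal \<bar>f x\<bar> + ennreal (D6 * real K) * (\<Sum>l<N. h l x)"
        by (intro add_left_mono avg)
      finally show "osc f s x / ?e \<le> ennreal \<bar>f x\<bar> + ennreal (D6 * real K) * (\<Sum>l<N. h l x)" .
    qed measurable
    also have "\<dots> \<le> X (\<lambda>x. ennreal \<bar>f x\<bar>) + X (\<lambda>x. ennreal (D6 * real K) * (\<Sum>l<N. h l x))"
      by (rule X_add) auto
    also have "X (\<lambda>x. ennreal (D6 * real K) * (\<Sum>l<N. h l x))
        = ennreal (D6 * real K) * X (\<lambda>x. \<Sum>l<N. h l x)"
      using D by (intro X_cmult) auto
    also have "X (\<lambda>x. \<Sum>l<N. h l x) \<le> (\<Sum>l<N. X (h l))" by (rule X_sum) auto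
    also have "\<dots> \<le> (\<Sum>l<N. X g)" by (intro sum_mono Xh)
    also have "\<dots> = of_nat N * X g" by simp
    also have "\<dots> \<le> of_nat N * (ennreal (1 + D4) * (X (\<lambda>x. ennreal \<bar>f x\<bar>) + osc_modulus M X f (1/2)))"
    proof (intro mult_left_mono)
      have "X g \<le> ennreal (1 + D4) * X (\<lambda>x. ennreal \<bar>f x\<bar>) + ennreal (1 + D4) * osc_modulus M X f (1/2)"
        using D mult_right_mono[of 1 "ennreal (1 + D4)" "X (\<lambda>x. ennreal \<bar>f x\<bar>)"]
        by (intro order_trans[OF Xg] add_mono mult_right_mono ennreal_leI) auto
      thus "X g \<le> ennreal (1 + D4) * (X (\<lambda>x. ennreal \<bar>f x\<bar>) + osc_modulus M X f (1/2))"
        by (simp add: distrib_left)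
    qed auto
    finally have "osc_modulus M X f s \<le> X (\<lambda>x. ennreal \<bar>f x\<bar>) + ennreal (D6 * real K)
        * (of_nat N * (ennreal (1 + D4) * (X (\<lambda>x. ennreal \<bar>f x\<bar>) + osc_modulus M X f (1/2))))"
      by (simp add: add_left_mono mult_left_mono)
    \<comment> \<open>Adding the modulus at 1/2 to the first summand creates the common
      factor.\<close>
    also have "\<dots> \<le> (X (\<lambda>x. ennreal \<bar>f x\<bar>) + osc_modulus M X f (1/2)) + ennreal (D6 * real K)
        * (of_nat N * (ennreal (1 + D4) * (X (\<lambda>x. ennreal \<bar>f x\<bar>) + osc_modulus M X f (1/2))))"
      by (intro add_right_mono) simp
    also have "\<dots> = ennreal C * (X (\<lambda>x. ennreal \<bar>f x\<bar>) + osc_modulus M X f (1/2))"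
    proof -
      have "ennreal C = ennreal 1 + ennreal (D6 * real K * (real N * (1 + D4)))"
        unfolding C_def using D by (subst ennreal_plus[symmetric]) (auto simp: mult.assoc)
      also have "ennreal (D6 * real K * (real N * (1 + D4)))
          = ennreal (D6 * real K) * (ennreal (real N) * ennreal (1 + D4))"
        using D by (simp add: ennreal_mult del: ennreal_plus)
      finally have "ennreal C = 1 + ennreal (D6 * real K) * (of_nat N * ennreal (1 + D4))"
        by (simp add: ennreal_of_nat_eq_real_of_nat del: ennreal_plus)
      thus ?thesis by (simp only: distrib_right mult_1 mult.assoc)
    qed
    finally show ?thesis .
  qed
  have "C > 0" unfolding C_def using D by (intro add_pos_nonneg mult_nonneg_nonneg) auto
  thus thesis using bnd by (rule that)
qed

end

section \<open>The embeddings\<close>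

text \<open>With \<epsilon> = 1, the function t b(t) is equivalent to an increasing one, so s b(s)
  is at most a multiple of t b(t) \<le> 2s b(t). The power of \<open>t\<close> changes by at most
  2^\<theta>.\<close>

lemma slowly_varying_weight_doubling:
  assumes "slowly_varying b" "0 < \<theta>"
  obtains B where "B > 0"
    "\<And>s t. 0 < s \<Longrightarrow> s \<le> t \<Longrightarrow> t \<le> 2 * s \<Longrightarrow> s powr (-\<theta>) * b s \<le> B * (t powr (-\<theta>) * b t)"
proof -
  have bpos: "b t > 0" if "t > 0" for t using assms(1) that by (simp add: slowly_varying_def)
  have "\<exists>g c C. mono_on {0<..} g \<and> 0 < c \<and> 0 < C \<and>
      (\<forall>t>0. c * g t \<le> t powr 1 * b t \<and> t powr 1 * b t \<le> C * g t)"
    by (rule conjunct1[OF assms(1)[unfolded slowly_varying_def, THEN conjunct2, THEN conjunct2,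
          rule_format, OF zero_less_one]])
  then obtain g c C where g: "mono_on {0<..} g" "0 < c" "0 < C"
    "\<And>t. t > 0 \<Longrightarrow> c * g t \<le> t powr 1 * b t \<and> t powr 1 * b t \<le> C * g t"
    by blast
  have "s powr (-\<theta>) * b s \<le> (2 powr \<theta> * (2 * C / c)) * (t powr (-\<theta>) * b t)"
    if st: "0 < s" "s \<le> t" "t \<le> 2 * s" for s t
  proof -
    have "s * b s \<le> C * g s" using g(4)[of s] st by simp
    also have "\<dots> \<le> C * g t" using g(1,3) st by (intro mult_left_mono) (auto simp: mono_on_def)
    also have "\<dots> \<le> C * (t * b t / c)" using g(2,3) g(4)[of t] st by (intro mult_left_mono) (auto simp: field_simps)
    also have "\<dots> \<le> C * ((2 * s) * b t / c)"
      using g(2,3) st bpos[of t] by (intro mult_left_mono divide_right_mono mult_right_mono) auto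
    finally have "s * b s \<le> s * (2 * C / c * b t)" by (simp add: field_simps)
    hence 1: "b s \<le> 2 * C / c * b t" using st by (simp only: mult_le_cancel_left_pos)
    have "t powr \<theta> \<le> (2 * s) powr \<theta>" using st assms(2) by (intro powr_mono2) auto
    hence 2: "s powr (-\<theta>) \<le> 2 powr \<theta> * t powr (-\<theta>)"
      using st by (simp add: powr_minus powr_mult field_simps)
    have "s powr (-\<theta>) * b s \<le> (2 powr \<theta> * t powr (-\<theta>)) * (2 * C / c * b t)"
      using 1 2 bpos[of s] st by (intro mult_mono) auto
    thus ?thesis by (simp add: ac_simps)
  qed
  thus thesis using g(2,3) by (intro that[of "2 powr \<theta> * (2 * C / c)"]) auto
qed

text \<open>Both parts of a splitting with finite norms are measurable, because
  \<open>space_norm\<close> is top elsewhere; membership in a Besov space therefore yields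
  measurability.\<close>

lemma sum_norm_finite_measurable:
  assumes "sum_norm (L1_norm M) (Linf_norm M) f < top"
  shows "f \<in> borel_measurable M"
proof -
  from assms obtain g where g: "L1_norm M g + Linf_norm M (\<lambda>x. f x - g x) < top"
    unfolding sum_norm_def by (auto simp: INF_less_iff)
  hence "g \<in> borel_measurable M" "(\<lambda>x. f x - g x) \<in> borel_measurable M"
    by (auto simp: L1_norm_def Linf_norm_def space_norm_def split: if_splits)
  hence "(\<lambda>x. g x + (f x - g x)) \<in> borel_measurable M" by measurable
  thus ?thesis by simp
qed

lemma rd_space_doubling_space:
  assumes "rd_space k n M"
  obtains C1 C2 where "doubling_space M k n C1 C2"
proof -
  from assms obtain C1 C2 where "0 < C1" "1 \<le> C2"
    and "\<forall>x r l. 0 < r \<longrightarrow> 1 \<le> l \<longrightarrow>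
          C1 * l powr k * measure M (ball x r) \<le> measure M (ball x (l * r)) \<and>
          measure M (ball x (l * r)) \<le> C2 * l powr n * measure M (ball x r)"
    unfolding rd_space_def by (elim conjE exE)
  with assms have "doubling_space M k n C1 C2"
    by (unfold_locales) (simp_all add: rd_space_def metric_measure_space_def)
  thus thesis by (rule that)
qed

section \<open>The weighted modulus and the two embeddings\<close>

context ri_doubling_space
begin

definition weighted_modulus :: "real \<Rightarrow> (real \<Rightarrow> real) \<Rightarrow> ('a \<Rightarrow> real) \<Rightarrow> real \<Rightarrow> ennreal" where
  "weighted_modulus \<theta> b f t = ennreal (t powr (-\<theta>) * b t) * osc_modulus M X f t"

lemma weighted_modulus_measurable:
  assumes "slowly_varying b" "f \<in> borel_measurable M"
  shows "weighted_modulus \<theta> b f \<in> borel_measurable leb_pos"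
proof -
  have [measurable]: "b \<in> borel_measurable leb_pos" using assms(1) by (simp add: slowly_varying_def)
  have [measurable]: "osc_modulus M X f \<in> borel_measurable leb_pos"
    by (intro borel_measurable_leb_pos osc_modulus_measurable assms(2))
  have [measurable]: "(\<lambda>t::real. t powr (-\<theta>)) \<in> borel_measurable leb_pos"
    by (intro borel_measurable_leb_pos) measurable
  show ?thesis unfolding weighted_modulus_def[abs_def] by measurable
qed

text \<open>By doubling, the weighted modulus on (s, 2s) is at least a fixed fraction of its value
  at \<open>s\<close>. The function \<phi> has to agree with it only there, so the bound serves for
  the full modulus and for its restriction to (0, 1).\<close>

lemma weighted_modulus_le_convexification:
  assumes F: "exact_interpolation_functor F" and b: "slowly_varying b" and "0 < \<theta>" "0 < p"
  shows "\<exists>C>0. \<forall>f\<in>borel_measurable M. \<forall>s>0. \<forall>\<phi>\<in>borel_measurable leb_pos.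
    (\<forall>t\<in>{s<..<2 * s}. \<phi> t = weighted_modulus \<theta> b f t) \<longrightarrow>
    weighted_modulus \<theta> b f s \<le> ennreal C * convexification p (tilde_norm F) \<phi>"
proof -
  obtain B where B: "B > 0"
    "\<And>s t. 0 < s \<Longrightarrow> s \<le> t \<Longrightarrow> t \<le> 2 * s \<Longrightarrow> s powr (-\<theta>) * b s \<le> B * (t powr (-\<theta>) * b t)"
    using slowly_varying_weight_doubling[OF b assms(3)] by metis
  obtain c where c: "c > 0"
    "\<forall>\<phi>\<in>borel_measurable leb_pos. \<forall>s>0. \<forall>l. (\<forall>t\<in>{s<..<2 * s}. l \<le> \<phi> t) \<longrightarrow>
       l \<le> ennreal c * convexification p (tilde_norm F) \<phi>"
    using convexification_lower_bound[OF F assms(4)] by blast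
  define D where "D = B * (C2 * 2 powr n)"
  have D: "D > 0" using B(1) C2 by (simp add: D_def)
  have "weighted_modulus \<theta> b f s \<le> ennreal (D * c) * convexification p (tilde_norm F) \<phi>"
    if f: "f \<in> borel_measurable M" and s: "s > 0" and \<phi>: "\<phi> \<in> borel_measurable leb_pos"
      and eq: "\<And>t. t \<in> {s<..<2 * s} \<Longrightarrow> \<phi> t = weighted_modulus \<theta> b f t" for f s \<phi>
  proof -
    have "ennreal (1 / D) * weighted_modulus \<theta> b f s \<le> \<phi> t" if t: "t \<in> {s<..<2 * s}" for t
    proof -
      have "b t > 0" using b t s by (simp add: slowly_varying_def)
      have "weighted_modulus \<theta> b f s
          \<le> ennreal (B * (t powr (-\<theta>) * b t)) * (ennreal (C2 * 2 powr n) * osc_modulus M X f t)"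
        unfolding weighted_modulus_def using s t f
        by (intro mult_mono[OF ennreal_leI[OF B(2)] osc_modulus_doubling]) auto
      also have "\<dots> = ennreal D * \<phi> t"
        unfolding eq[OF t] weighted_modulus_def D_def using B(1) C2 \<open>b t > 0\<close>
        by (simp add: ennreal_mult ac_simps)
      finally have "ennreal (1 / D) * weighted_modulus \<theta> b f s \<le> ennreal (1 / D) * (ennreal D * \<phi> t)"
        by (rule mult_left_mono) simp
      also have "\<dots> = \<phi> t" using D by (simp add: mult.assoc[symmetric] ennreal_mult[symmetric])
      finally show ?thesis .
    qed
    hence "ennreal (1 / D) * weighted_modulus \<theta> b f s
        \<le> ennreal c * convexification p (tilde_norm F) \<phi>"
      using c(2) \<phi> s by blast
    hence "ennreal D * (ennreal (1 / D) * weighted_modulus \<theta> b f s)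
        \<le> ennreal D * (ennreal c * convexification p (tilde_norm F) \<phi>)"
      by (intro mult_left_mono) auto
    thus ?thesis using D c(1) by (simp add: mult.assoc[symmetric] ennreal_mult[symmetric])
  qed
  thus ?thesis using D c(1) by (intro exI[of _ "D * c"]) auto
qed

lemma hom_besov_embedding:
  assumes F: "exact_interpolation_functor F" and b: "slowly_varying b" and "0 < \<theta>" "0 < p" "p < q"
  shows "\<exists>C::real. C > 0 \<and> (\<forall>f\<in>borel_measurable M.
    hom_besov_norm M X (convexification q (tilde_norm F)) \<theta> b f
      \<le> ennreal C * hom_besov_norm M X (convexification p (tilde_norm F)) \<theta> b f)"
proof -
  obtain C where C: "C > 0"
    "\<forall>f\<in>borel_measurable M. \<forall>s>0. \<forall>\<phi>\<in>borel_measurable leb_pos.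
      (\<forall>t\<in>{s<..<2 * s}. \<phi> t = weighted_modulus \<theta> b f t) \<longrightarrow>
      weighted_modulus \<theta> b f s \<le> ennreal C * convexification p (tilde_norm F) \<phi>"
    using weighted_modulus_le_convexification[OF F b assms(3,4)] by blast
  \<comment> \<open>The constant 1 + C makes the right-hand side dominate both the pointwise bound
    and the norm for \<open>p\<close>.\<close>
  have "convexification q (tilde_norm F) (weighted_modulus \<theta> b f)
      \<le> ennreal (1 + C) * convexification p (tilde_norm F) (weighted_modulus \<theta> b f)"
    (is "_ \<le> _ * ?A") if f: "f \<in> borel_measurable M" for f
  proof (rule convexification_le_of_bounded[OF F assms(4,5)])
    show m: "weighted_modulus \<theta> b f \<in> borel_measurable leb_pos"
      by (rule weighted_modulus_measurable[OF b f])
    have "weighted_modulus \<theta> b f s \<le> ennreal (1 + C) * ?A" if "s > 0" for s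
    proof -
      have "weighted_modulus \<theta> b f s \<le> ennreal C * ?A" using C(2) f m that by blast
      also have "\<dots> \<le> ennreal (1 + C) * ?A" by (intro mult_right_mono ennreal_leI) auto
      finally show ?thesis .
    qed
    thus "AE s in leb_pos. weighted_modulus \<theta> b f s \<le> ennreal (1 + C) * ?A"
      by (intro AE_I2) simp
    show "?A \<le> ennreal (1 + C) * ?A"
      using C(1) mult_right_mono[of 1 "ennreal (1 + C)" ?A] by simp
  qed
  moreover have "1 + C > 0" using C(1) by simp
  ultimately show ?thesis unfolding hom_besov_norm_def weighted_modulus_def[abs_def] by blast
qed

lemma besov_embedding:
  assumes F: "exact_interpolation_functor F" and b: "slowly_varying b" and "0 < \<theta>" "0 < p" "p < q"
  shows "\<exists>C::real. C > 0 \<and> (\<forall>f\<in>borel_measurable M.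
    besov_norm M X (convexification q (tilde_norm F)) \<theta> b f
      \<le> ennreal C * besov_norm M X (convexification p (tilde_norm F)) \<theta> b f)"
proof -
  obtain C where C: "C > 0"
    "\<forall>f\<in>borel_measurable M. \<forall>s>0. \<forall>\<phi>\<in>borel_measurable leb_pos.
      (\<forall>t\<in>{s<..<2 * s}. \<phi> t = weighted_modulus \<theta> b f t) \<longrightarrow>
      weighted_modulus \<theta> b f s \<le> ennreal C * convexification p (tilde_norm F) \<phi>"
    using weighted_modulus_le_convexification[OF F b assms(3,4)] by blast
  obtain B where B: "B > 0"
    "\<And>s t. 0 < s \<Longrightarrow> s \<le> t \<Longrightarrow> t \<le> 2 * s \<Longrightarrow> s powr (-\<theta>) * b s \<le> B * (t powr (-\<theta>) * b t)"
    using slowly_varying_weight_doubling[OF b assms(3)] by metis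
  obtain C' where C': "C' > 0"
    "\<And>f s. f \<in> borel_measurable M \<Longrightarrow> 1/2 \<le> s \<Longrightarrow> s \<le> 1 \<Longrightarrow>
       osc_modulus M X f s \<le> ennreal C' * (X (\<lambda>x. ennreal \<bar>f x\<bar>) + osc_modulus M X f (1/2))"
    using osc_modulus_le_unit_scale by blast
  have bpos: "b t > 0" if "t > 0" for t using b that by (simp add: slowly_varying_def)
  \<comment> \<open>\<open>w\<close> is the weight at 1/2; dividing by it recovers the unweighted
    modulus there.\<close>
  define w where "w = (1/2) powr (-\<theta>) * b (1/2)"
  have w: "w > 0" using bpos by (simp add: w_def)
  define W where "W = B * b 1 * C'"
  have W: "W > 0" using B(1) bpos C'(1) by (simp add: W_def)
  \<comment> \<open>The summand 1 covers the norm for \<open>p\<close>, \<open>C\<close> the scales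
    up to 1/2, and the last two the terms of the bound between 1/2 and 1.\<close>
  define K where "K = 1 + C + W + W * C / w"
  have K: "K \<ge> 1" using C(1) W w by (simp add: K_def)
  have main: "convexification q (tilde_norm F) (\<lambda>t. weighted_modulus \<theta> b f t * indicator {0<..<1} t)
      \<le> ennreal K * (convexification p (tilde_norm F) (\<lambda>t. weighted_modulus \<theta> b f t * indicator {0<..<1} t)
          + space_norm M X f)"
    (is "convexification q _ ?\<phi> \<le> _ * (?A + ?n)") if f: "f \<in> borel_measurable M" for f
  proof (rule convexification_le_of_bounded[OF F assms(4,5)])
    let ?w = "weighted_modulus \<theta> b f"
    have [measurable]: "?w \<in> borel_measurable leb_pos" by (rule weighted_modulus_measurable[OF b f])
    have [measurable]: "(indicator {0<..<1} :: real \<Rightarrow> ennreal) \<in> borel_measurable leb_pos"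
      by (intro borel_measurable_leb_pos) measurable
    show m: "?\<phi> \<in> borel_measurable leb_pos" by measurable
    have n: "?n = X (\<lambda>x. ennreal \<bar>f x\<bar>)" using f by (simp add: space_norm_def)
    \<comment> \<open>For s \<le> 1/2 the interval (s, 2s) lies in (0, 1), where truncation changes
      nothing.\<close>
    have low: "?w s \<le> ennreal C * ?A" if "0 < s" "s \<le> 1/2" for s
      using that by (intro C(2)[rule_format] f m) auto
    have "ennreal w * osc_modulus M X f (1/2) \<le> ennreal C * ?A"
      using low[of "1/2"] by (simp add: weighted_modulus_def w_def)
    hence "ennreal (1 / w) * (ennreal w * osc_modulus M X f (1/2)) \<le> ennreal (1 / w) * (ennreal C * ?A)"
      by (intro mult_left_mono) auto
    hence half: "osc_modulus M X f (1/2) \<le> ennreal (C / w) * ?A"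
      using w C(1) by (simp add: mult.assoc[symmetric] ennreal_mult[symmetric])
    have high: "?w s \<le> ennreal W * ?n + ennreal (W * C / w) * ?A" if s: "1/2 \<le> s" "s \<le> 1" for s
    proof -
      \<comment> \<open>The weight is compared with its value at 1, which is allowed because 1 \<le>
        2s.\<close>
      have ws: "s powr (-\<theta>) * b s \<le> B * b 1" using B(2)[of s 1] s by simp
      have "?w s \<le> ennreal (B * b 1) * (ennreal C' * (?n + osc_modulus M X f (1/2)))"
        unfolding weighted_modulus_def n by (rule mult_mono[OF ennreal_leI[OF ws] C'(2)[OF f s]]) auto
      also have "\<dots> = ennreal W * (?n + osc_modulus M X f (1/2))"
        unfolding W_def using B(1) bpos[of 1] C'(1) by (simp add: ennreal_mult mult.assoc)
      also have "\<dots> \<le> ennreal W * (?n + ennreal (C / w) * ?A)"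
        by (intro mult_left_mono add_left_mono half) auto
      also have "\<dots> = ennreal W * ?n + ennreal (W * C / w) * ?A"
        using W C(1) w by (simp add: distrib_left mult.assoc[symmetric] ennreal_mult[symmetric])
      finally show ?thesis .
    qed
    have "?\<phi> s \<le> ennreal K * (?A + ?n)" if s: "s > 0" for s
    proof -
      consider "s \<le> 1/2" | "1/2 \<le> s" "s < 1" | "1 \<le> s" by linarith
      thus ?thesis
      proof cases
        case 1
        have "?\<phi> s \<le> ennreal C * ?A" using low[OF s 1] s 1 by simp
        also have "\<dots> \<le> ennreal K * (?A + ?n)"
          using W w C(1) by (intro mult_mono ennreal_leI) (auto simp: K_def)
        finally show ?thesis .
      next
        case 2
        have "?\<phi> s \<le> ennreal W * ?n + ennreal (W * C / w) * ?A" using high[of s] s 2 by simp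
        also have "\<dots> \<le> ennreal K * ?n + ennreal K * ?A"
          using W w C(1) by (intro add_mono mult_right_mono ennreal_leI) (auto simp: K_def)
        also have "\<dots> = ennreal K * (?A + ?n)" by (simp add: distrib_left add.commute)
        finally show ?thesis .
      qed simp
    qed
    thus "AE s in leb_pos. ?\<phi> s \<le> ennreal K * (?A + ?n)" by (intro AE_I2) simp
    have "1 * ?A \<le> ennreal K * (?A + ?n)" using K by (intro mult_mono) auto
    thus "?A \<le> ennreal K * (?A + ?n)" by simp
  qed
  \<comment> \<open>The additional 1 in the constant pays for the norm of \<open>f\<close> in
    \<open>X\<close> on the left.\<close>
  have "besov_norm M X (convexification q (tilde_norm F)) \<theta> b f
      \<le> ennreal (K + 1) * besov_norm M X (convexification p (tilde_norm F)) \<theta> b f"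
    if f: "f \<in> borel_measurable M" for f
  proof -
    let ?A = "convexification p (tilde_norm F) (\<lambda>t. weighted_modulus \<theta> b f t * indicator {0<..<1} t)"
    let ?n = "space_norm M X f"
    have "besov_norm M X (convexification q (tilde_norm F)) \<theta> b f \<le> ennreal K * (?A + ?n) + 1 * (?A + ?n)"
      unfolding besov_norm_def weighted_modulus_def[symmetric] using main[OF f]
      by (intro add_mono) auto
    also have "\<dots> = ennreal (K + 1) * (?A + ?n)"
      using K by (simp only: distrib_right ennreal_plus ennreal_1 zero_le_one order_trans[OF zero_le_one])
    finally show ?thesis unfolding besov_norm_def weighted_modulus_def .
  qed
  thus ?thesis using K by (intro exI[of _ "K + 1"]) auto
qed

end

theorem proposition6:
  fixes M :: "'a::metric_space measure"
    and X :: "('a \<Rightarrow> ennreal) \<Rightarrow> ennreal"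
    and F :: "((real \<Rightarrow> real) \<Rightarrow> ennreal) \<Rightarrow> ((real \<Rightarrow> real) \<Rightarrow> ennreal) \<Rightarrow> (real \<Rightarrow> real) \<Rightarrow> ennreal"
    and E :: "(real \<Rightarrow> ennreal) \<Rightarrow> ennreal"
    and b :: "real \<Rightarrow> real"
    and k n \<theta> p q :: real
  assumes "rd_space k n M"
    and "ri_norm M X"
    and "besov_parameter F E"
    and "slowly_varying b"
    and "0 < \<theta>"
    and "1 \<le> p" and "p < q"
  shows "(\<exists>C::real. C > 0 \<and>
            (\<forall>f \<in> hom_besov_space M X (convexification p (tilde_norm F)) \<theta> b.
               f \<in> hom_besov_space M X (convexification q (tilde_norm F)) \<theta> b \<and>
               hom_besov_norm M X (convexification q (tilde_norm F)) \<theta> b f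
                 \<le> ennreal C * hom_besov_norm M X (convexification p (tilde_norm F)) \<theta> b f)) \<and>
         (\<exists>C::real. C > 0 \<and>
            (\<forall>f \<in> besov_space M X (convexification p (tilde_norm F)) \<theta> b.
               f \<in> besov_space M X (convexification q (tilde_norm F)) \<theta> b \<and>
               besov_norm M X (convexification q (tilde_norm F)) \<theta> b f
                 \<le> ennreal C * besov_norm M X (convexification p (tilde_norm F)) \<theta> b f))"
proof -
  obtain C1 C2 where "doubling_space M k n C1 C2"
    using rd_space_doubling_space[OF assms(1)] by blast
  then interpret ri_doubling_space M k n C1 C2 X
    using assms(2) by (simp add: ri_doubling_space_def ri_function_norm_def)
  have F: "exact_interpolation_functor F" using assms(3) by (simp add: besov_parameter_def)
  have p: "0 < p" using assms(6) by simp
  let ?H = "\<lambda>p. hom_besov_space M X (convexification p (tilde_norm F)) \<theta> b"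
  let ?B = "\<lambda>p. besov_space M X (convexification p (tilde_norm F)) \<theta> b"
  obtain C where C: "C > 0" "\<forall>f\<in>borel_measurable M.
      hom_besov_norm M X (convexification q (tilde_norm F)) \<theta> b f
        \<le> ennreal C * hom_besov_norm M X (convexification p (tilde_norm F)) \<theta> b f"
    using hom_besov_embedding[OF F assms(4,5) p assms(7)] by (elim exE conjE)
  obtain C' where C': "C' > 0" "\<forall>f\<in>borel_measurable M.
      besov_norm M X (convexification q (tilde_norm F)) \<theta> b f
        \<le> ennreal C' * besov_norm M X (convexification p (tilde_norm F)) \<theta> b f"
    using besov_embedding[OF F assms(4,5) p assms(7)] by (elim exE conjE)
  \<comment> \<open>The embedding constants are stated for measurable functions; the finite sum norm
    of a member provides measurability.\<close>
  have meas: "f \<in> borel_measurable M" if "f \<in> ?H p" for f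
    using that by (auto simp: hom_besov_space_def intro: sum_norm_finite_measurable)
  have H: "f \<in> ?H q" if f: "f \<in> ?H p" for f
  proof -
    have "ennreal C * hom_besov_norm M X (convexification p (tilde_norm F)) \<theta> b f < top"
      using f by (simp add: hom_besov_space_def ennreal_mult_less_top)
    with C(2)[rule_format, OF meas[OF f]]
    have "hom_besov_norm M X (convexification q (tilde_norm F)) \<theta> b f < top"
      by (rule le_less_trans)
    with f show ?thesis by (simp add: hom_besov_space_def)
  qed
  have B: "f \<in> ?H p" "f \<in> ?B q" if "f \<in> ?B p" for f
    using that H[of f] by (simp_all add: besov_space_def)
  show ?thesis
    by (intro conjI exI[of _ C] exI[of _ C'] ballI C(1) C'(1) H B(2)
        C(2)[rule_format] C'(2)[rule_format] meas[OF B(1)] meas)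
qed

end
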